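(* Let $I=\mathbb R/l\mathbb Z$ for some $l>0$ or $I=\mathbb R$, and let $\gamma:I\to\mathbb R^2$ be a properly embedded smooth curve parameterized by arc length satisfying $$p.v.\int_I\frac{\kappa_\gamma(x,y)-\kappa_\gamma(x)}{|\gamma(y)-\gamma(x)|^2}\,dy=0\qquad\text{for all }x\in I .$$ Then $\gamma$ is either a straight line or a circle.
   Context: $\kappa_\gamma(x)=\gamma''(x)$ is the curvature vector of the arc-length parameterized curve $\gamma$ at $x$. For $x\ne y$ in $I$ there is either a unique circle or a straight line through $\gamma(x)$ and $\gamma(y)$ that is tangent to $\gamma$ at $x$; $\kappa_\gamma(x,y)$ denotes the curvature vector of this circle at $\gamma(x)$, and $\kappa_\gamma(x,y)=0$ if the tangent to $\gamma$ at $x$ points in the direction of $\gamma(y)$. Equivalently, $\kappa_\gamma(x,y)=2P^\bot_{\gamma'(x)}(\gamma(y)-\gamma(x))/|\gamma(y)-\gamma(x)|^2$, where $P^\bot_{\gamma'(x)}$ is the orthogonal projection onto the orthogonal complement of $\gamma'(x)$. $p.v.\int_I$ denotes the Cauchy principal value, i.e. the limit as $\epsilon\downarrow0$ of the integral over $\{y\in I:|y-x|\ge\epsilon\}$ (distance in $I$). *)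

theory Defs
  imports "HOL-Analysis.Analysis"
begin

(* The parameter space I: the real line, or the circle of length l (the reals modulo l * Z).
   A map on the circle is represented by its l-periodic lift to the reals. *)
datatype param_space = Real_Line | Real_Mod real

primrec representatives :: "param_space \<Rightarrow> real set" where
  "representatives Real_Line = UNIV"
| "representatives (Real_Mod l) = {0..<l}"

primrec param_dist :: "param_space \<Rightarrow> real \<Rightarrow> real \<Rightarrow> real" where
  "param_dist Real_Line x y = \<bar>y - x\<bar>"
| "param_dist (Real_Mod l) x y = (INF k::int. \<bar>y - x + of_int k * l\<bar>)"

definition vderiv :: "(real \<Rightarrow> 'a::real_normed_vector) \<Rightarrow> real \<Rightarrow> 'a" where
  "vderiv f t = vector_derivative f (at t)"

definition smooth_curve :: "(real \<Rightarrow> 'a::real_normed_vector) \<Rightarrow> bool" where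
  "smooth_curve \<gamma> \<longleftrightarrow> (\<forall>n t. (vderiv ^^ n) \<gamma> differentiable at t)"

definition arc_length_parameterized :: "(real \<Rightarrow> 'a::real_normed_vector) \<Rightarrow> bool" where
  "arc_length_parameterized \<gamma> \<longleftrightarrow> (\<forall>t. norm (vderiv \<gamma> t) = 1)"

(* Topological part of being properly embedded; the immersion property is part of
   arc_length_parameterized. An injective proper map into Euclidean space is an embedding with
   closed image. The right-to-left direction on the circle expresses l-periodicity of the lift;
   properness is automatic there because the circle is compact. *)
primrec properly_embedded :: "param_space \<Rightarrow> (real \<Rightarrow> 'a::real_normed_vector) \<Rightarrow> bool" where
  "properly_embedded Real_Line \<gamma> \<longleftrightarrow> inj \<gamma> \<and> proper_map euclidean euclidean \<gamma>"
| "properly_embedded (Real_Mod l) \<gamma> \<longleftrightarrow>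
     (\<forall>s t. \<gamma> s = \<gamma> t \<longleftrightarrow> (\<exists>k::int. t = s + of_int k * l))"

definition curvature :: "(real \<Rightarrow> real^2) \<Rightarrow> real \<Rightarrow> real^2" where
  "curvature \<gamma> x = vderiv (vderiv \<gamma>) x"

(* The circle through p and q with centre c and radius r is tangent to the direction v at p iff
   c - p is orthogonal to v; its curvature vector at p points from p to c and has length 1 / r. *)
definition tangent_circle_curvature :: "real^2 \<Rightarrow> real^2 \<Rightarrow> real^2 \<Rightarrow> real^2" where
  "tangent_circle_curvature p v q =
     (if q - p \<in> span {v} then 0
      else (THE k. \<exists>c r. r > 0 \<and> p \<in> sphere c r \<and> q \<in> sphere c r \<and> orthogonal (c - p) v \<and>
                         k = (c - p) /\<^sub>R r\<^sup>2))"

definition curvature2 :: "(real \<Rightarrow> real^2) \<Rightarrow> real \<Rightarrow> real \<Rightarrow> real^2" where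
  "curvature2 \<gamma> x y = tangent_circle_curvature (\<gamma> x) (vderiv \<gamma> x) (\<gamma> y)"

(* The integrals are gauge (Henstock-Kurzweil) integrals, which for I = R extend both the
   Lebesgue integral and the convergent improper Riemann integral. Existence of the integrals
   for every epsilon > 0 is part of the predicate. *)
definition has_pv_integral ::
  "param_space \<Rightarrow> real \<Rightarrow> (real \<Rightarrow> 'a::real_normed_vector) \<Rightarrow> 'a \<Rightarrow> bool" where
  "has_pv_integral I x f L \<longleftrightarrow>
     (\<exists>J. (\<forall>\<epsilon>>0. (f has_integral J \<epsilon>) {y \<in> representatives I. param_dist I x y \<ge> \<epsilon>}) \<and>
          (J \<longlongrightarrow> L) (at_right 0))"

definition is_straight_line :: "(real^2) set \<Rightarrow> bool" where
  "is_straight_line S \<longleftrightarrow> (\<exists>a v. v \<noteq> 0 \<and> S = {a + t *\<^sub>R v | t. True})"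

definition is_circle :: "(real^2) set \<Rightarrow> bool" where
  "is_circle S \<longleftrightarrow> (\<exists>c r. r > 0 \<and> S = sphere c r)"

lemma tangent_circle_curvature_eq:
  fixes p q v :: "real^2"
  assumes v: "norm v = 1"
  shows "tangent_circle_curvature p v q =
           (2 / (norm (q - p))\<^sup>2) *\<^sub>R ((q - p) - ((q - p) \<bullet> v) *\<^sub>R v)"
proof (cases "q - p \<in> span {v}")
  case True
  then obtain a where a: "q - p = a *\<^sub>R v"
    by (auto simp: span_singleton)
  have "v \<bullet> v = 1" using v by (simp add: dot_square_norm)
  then show ?thesis using True by (simp add: tangent_circle_curvature_def a)
next
  case False
  define w where "w = q - p"
  define n where "n = w - (w \<bullet> v) *\<^sub>R v"
  define k where "k = (2 / (norm w)\<^sup>2) *\<^sub>R n"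
  have vv: "v \<bullet> v = 1" using v by (simp add: dot_square_norm)
  have n0: "n \<noteq> 0"
    using False by (auto simp: n_def w_def span_singleton)
  have w0: "w \<noteq> 0" using n0 by (auto simp: n_def)
  have nv: "n \<bullet> v = 0" by (simp add: n_def inner_diff_left vv)
  have wn: "w \<bullet> n = n \<bullet> n"
    using nv by (simp add: n_def inner_diff_left inner_diff_right inner_commute)
  then have nw: "n \<bullet> w = n \<bullet> n" by (simp add: inner_commute)
  have nn: "n \<bullet> n > 0" using n0 by simp
  have ww: "w \<bullet> w > 0" using w0 by simp
  have ortho: "\<exists>a. s = a *\<^sub>R n" if "s \<bullet> v = 0" for s :: "real^2"
  proof -
    have sv: "s$1 * v$1 + s$2 * v$2 = 0" and nv': "n$1 * v$1 + n$2 * v$2 = 0"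
      and vv': "v$1 * v$1 + v$2 * v$2 = 1" and nn': "n \<bullet> n = n$1 * n$1 + n$2 * n$2"
      and sn: "s \<bullet> n = s$1 * n$1 + s$2 * n$2"
      using that nv vv by (simp_all add: inner_vec_def sum_2)
    have det: "s$1 * n$2 = s$2 * n$1"
      using sv nv' vv' by algebra
    have "(n \<bullet> n) *\<^sub>R s = (s \<bullet> n) *\<^sub>R n"
      unfolding vec_eq_iff forall_2 nn' sn using det
      by (simp add: algebra_simps)
    then have "(1 / (n \<bullet> n)) *\<^sub>R ((n \<bullet> n) *\<^sub>R s) = (1 / (n \<bullet> n)) *\<^sub>R ((s \<bullet> n) *\<^sub>R n)"
      by simp
    then have "s = ((s \<bullet> n) / (n \<bullet> n)) *\<^sub>R n"
      using nn by simp
    then show ?thesis by blast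
  qed
  have "(THE k. \<exists>c r. r > 0 \<and> p \<in> sphere c r \<and> q \<in> sphere c r \<and> orthogonal (c - p) v \<and>
           k = (c - p) /\<^sub>R r\<^sup>2) = k"
  proof (rule the_equality)
    define s where "s = ((w \<bullet> w) / (2 * (n \<bullet> n))) *\<^sub>R n"
    have s0: "s \<noteq> 0" using ww nn n0 by (auto simp: s_def)
    have sw: "2 * (s \<bullet> w) = w \<bullet> w"
      using nn by (simp add: s_def nw)
    have "norm (s - w) ^ 2 = norm s ^ 2"
      unfolding dot_square_norm[symmetric] using sw
      by (simp add: inner_diff_left inner_diff_right inner_commute)
    then have eq: "norm (s - w) = norm s" by simp
    have ns: "(norm s)\<^sup>2 = (w \<bullet> w)\<^sup>2 / (4 * (n \<bullet> n))"
      using nn unfolding power2_norm_eq_inner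
      by (simp add: s_def field_simps power2_eq_square)
    have "k = s /\<^sub>R (norm s)\<^sup>2"
      unfolding ns k_def power2_norm_eq_inner
      using ww nn by (simp add: s_def field_simps power2_eq_square)
    moreover have "dist (p + s) q = norm s"
      using eq by (simp add: dist_norm w_def algebra_simps)
    ultimately show "\<exists>c r. r > 0 \<and> p \<in> sphere c r \<and> q \<in> sphere c r \<and> orthogonal (c - p) v \<and>
           k = (c - p) /\<^sub>R r\<^sup>2"
      using s0 nv
      by (intro exI[of _ "p + s"] exI[of _ "norm s"])
         (auto simp: dist_norm orthogonal_def s_def)
  next
    fix k' assume "\<exists>c r. r > 0 \<and> p \<in> sphere c r \<and> q \<in> sphere c r \<and> orthogonal (c - p) v \<and>
           k' = (c - p) /\<^sub>R r\<^sup>2"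
    then obtain c r where r: "r > 0" and p: "norm (c - p) = r" and q: "norm (c - q) = r"
      and o: "(c - p) \<bullet> v = 0" and k': "k' = (c - p) /\<^sub>R r\<^sup>2"
      unfolding mem_sphere dist_norm orthogonal_def by blast
    define s where "s = c - p"
    have "norm (s - w) = norm s" using p q by (simp add: s_def w_def)
    then have "(s - w) \<bullet> (s - w) = s \<bullet> s" by (simp add: dot_square_norm)
    then have sw: "2 * (s \<bullet> w) = w \<bullet> w"
      by (simp add: inner_diff_left inner_diff_right inner_commute)
    obtain a where a: "s = a *\<^sub>R n" using ortho o by (auto simp: s_def)
    have aw: "2 * a * (n \<bullet> n) = w \<bullet> w" using sw by (simp add: a nw)
    then have a0: "a \<noteq> 0" using ww by auto
    have r2: "r\<^sup>2 = a\<^sup>2 * (n \<bullet> n)"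
    proof -
      have "r\<^sup>2 = s \<bullet> s" by (simp add: s_def p[symmetric] power2_norm_eq_inner)
      then show ?thesis by (simp add: a power2_eq_square)
    qed
    have "k' = (a / (a\<^sup>2 * (n \<bullet> n))) *\<^sub>R n"
      unfolding k' r2 s_def[symmetric] a by (simp add: divide_inverse mult_ac)
    also have "a / (a\<^sup>2 * (n \<bullet> n)) = 2 / (w \<bullet> w)"
      using a0 nn by (simp add: aw[symmetric] power2_eq_square)
    finally show "k' = k" by (simp add: k_def dot_square_norm)
  qed
  then show ?thesis
    using False by (simp add: tangent_circle_curvature_def k_def n_def w_def)
qed

end

theory Submission
  imports Defs
begin

text \<open>
  Call \<open>k(x, y)\<close> the signed curvature, with respect to a fixed choice of normal, of the circle that
  is tangent to the curve at parameter \<open>x\<close> and passes through the point at \<open>y\<close>, and let \<open>k(x, x)\<close> be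
  the curvature at \<open>x\<close>. If some \<open>z\<close> satisfies \<open>k(z, u) \<le> k(z, z)\<close> for all \<open>u\<close>, that is, if the
  osculating circle at \<open>z\<close> has the curve on one side, then the integrand of the principal value at
  \<open>z\<close> has a sign. The integrals over \<open>{y. \<bar>y - z\<bar> \<ge> \<epsilon>}\<close> are then monotone in \<open>\<epsilon>\<close> and tend to \<open>0\<close>, so
  they all vanish and \<open>k(z, u) = k(z, z)\<close> for all \<open>u\<close>: the whole curve lies on its osculating circle
  (or line) at \<open>z\<close>, and by unit speed it covers it (\<open>curve_in_tangent_circle\<close>, \<open>range_line\<close>,
  \<open>range_circle\<close>).

  Such a vertex \<open>z\<close> is found by an argument in the style of Pestov and Ionin. If \<open>k(x, _)\<close> has a
  positive maximum at \<open>y\<close>, the disc of curvature \<open>k(x, y)\<close> tangent at \<open>x\<close> is free of the curve and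
  touches it at \<open>y\<close> as well; call \<open>(x, y)\<close> a touching pair. The arc between \<open>x\<close> and \<open>y\<close> together with
  the chord of that disc is a Jordan curve. If the rest of the curve lies outside, then the normal
  side of the arc is inside, and for a parameter \<open>t\<close> in the middle of the arc the maximal tangent disc
  is trapped: it is bounded and touches the curve again on the same arc (\<open>trapped\<close>). This gives a
  touching pair at half the parameter distance. Repetition yields touching pairs whose two points
  converge to a common limit \<open>z\<close>, and as \<open>k\<close> is continuous up to the diagonal, \<open>z\<close> is a vertex
  (\<open>vertex_between\<close>).

  It remains to start. On the line, if \<open>k\<close> is positive somewhere for one of the two normals, it
  attains a positive maximum because \<open>k(x, y)\<close> tends to \<open>0\<close> as the proper curve leaves bounded sets,
  and the ends of the curve go to infinity outside every loop; if \<open>k\<close> vanishes identically, every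
  parameter is a vertex. On the circle the start is a rightmost point with the normal that points to
  the left. Of the two arcs that its touching pair determines, one avoids a leftmost or a topmost
  point, and from that extreme point the complementary arc escapes to infinity along a ray.

  Only one half of the symmetry between the two ends of an arc is proved directly; the other half is
  obtained by reversing the parameter, which exchanges the two normals relative to the direction of
  travel but not the normal vectors. The plane is identified with \<open>\<complex>\<close>, so that a rotation by a right
  angle is a multiplication by \<open>\<plusminus> \<i>\<close>.
\<close>

section \<open>Curvature of tangent circles\<close>

text \<open>
  The sign of \<open>c\<close> selects the normal \<open>c * T t\<close>. The condition \<open>recur\<close> holds both for injective curves
  and for periodic lifts of simple closed curves; it says that a curve which returns to a point
  continues as before.
\<close>
locale unit_speed_curve =
  fixes g T A :: "real \<Rightarrow> complex" and c :: complex
  assumes der_g: "(g has_vector_derivative T t) (at t)"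
    and der_T: "(T has_vector_derivative A t) (at t)"
    and cont_A: "continuous_on UNIV A"
    and norm_T: "norm (T t) = 1"
    and recur: "g s = g t \<Longrightarrow> g (u + (t - s)) = g u"
    and side: "c = \<i> \<or> c = -\<i>"
begin

definition N :: "real \<Rightarrow> complex" where "N t = c * T t"

text \<open>
  The curvature, signed by the normal at \<open>x\<close>, of the circle tangent to the curve at \<open>g x\<close> and through
  \<open>g y\<close>. The value for \<open>g y = g x\<close> is the signed curvature at \<open>x\<close>, which makes the function continuous.
\<close>
definition chord_curv :: "real \<Rightarrow> real \<Rightarrow> real" where
  "chord_curv x y =
     (if g y = g x then A x \<bullet> N x else 2 * ((g y - g x) \<bullet> N x) / (norm (g y - g x))\<^sup>2)"

lemma TT: "T t \<bullet> T t = 1"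
  using norm_T[of t] by (simp add: dot_square_norm)

lemma NN: "N t \<bullet> N t = 1" and TN: "T t \<bullet> N t = 0" and NT: "N t \<bullet> T t = 0"
  and norm_N: "norm (N t) = 1"
proof -
  have 1: "Re (T t) * Re (T t) + Im (T t) * Im (T t) = 1"
    using TT[of t] by (simp add: inner_complex_def)
  show NN: "N t \<bullet> N t = 1" using side 1 by (auto simp: N_def inner_complex_def)
  show "T t \<bullet> N t = 0" "N t \<bullet> T t = 0"
    using side by (auto simp: N_def inner_complex_def)
  show "norm (N t) = 1" using NN by (simp add: norm_eq_1)
qed

lemma frame_decomposition: "z = (z \<bullet> T t) *\<^sub>R T t + (z \<bullet> N t) *\<^sub>R N t"
proof -
  have 1: "Re (T t) * Re (T t) + Im (T t) * Im (T t) = 1"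
    using TT[of t] by (simp add: inner_complex_def)
  have 2: "z = (z \<bullet> T t) *\<^sub>R T t + (z \<bullet> (d * T t)) *\<^sub>R (d * T t)" if "d = \<i> \<or> d = -\<i>" for d
    using that
  proof (elim disjE)
    assume "d = \<i>"
    then show ?thesis
      unfolding complex_eq_iff using 1 by (simp add: inner_complex_def) algebra
  next
    assume "d = -\<i>"
    then show ?thesis
      unfolding complex_eq_iff using 1 by (simp add: inner_complex_def) algebra
  qed
  show ?thesis unfolding N_def by (rule 2[OF side])
qed

lemma norm_frame: "(norm z)\<^sup>2 = (z \<bullet> T t)\<^sup>2 + (z \<bullet> N t)\<^sup>2"
proof -
  have "z \<bullet> z = z \<bullet> ((z \<bullet> T t) *\<^sub>R T t + (z \<bullet> N t) *\<^sub>R N t)"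
    using frame_decomposition[of z t] by simp
  also have "\<dots> = (z \<bullet> T t)\<^sup>2 + (z \<bullet> N t)\<^sup>2"
    by (simp only: inner_add_right inner_scaleR_right power2_eq_square)
  finally show ?thesis by (simp add: power2_norm_eq_inner)
qed

lemma cont_T: "continuous_on UNIV T" and cont_g: "continuous_on UNIV g"
  and cont_N: "continuous_on UNIV N"
proof -
  show "continuous_on UNIV g"
    using der_g by (meson UNIV_I continuous_at_imp_continuous_on has_vector_derivative_continuous)
  show T: "continuous_on UNIV T"
    using der_T by (meson UNIV_I continuous_at_imp_continuous_on has_vector_derivative_continuous)
  show "continuous_on UNIV N"
    unfolding N_def by (intro continuous_intros T)
qed

lemma tendsto_g: "(f \<longlongrightarrow> a) F \<Longrightarrow> ((\<lambda>x. g (f x)) \<longlongrightarrow> g a) F"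
  and tendsto_T: "(f \<longlongrightarrow> a) F \<Longrightarrow> ((\<lambda>x. T (f x)) \<longlongrightarrow> T a) F"
  and tendsto_A: "(f \<longlongrightarrow> a) F \<Longrightarrow> ((\<lambda>x. A (f x)) \<longlongrightarrow> A a) F"
  and tendsto_N: "(f \<longlongrightarrow> a) F \<Longrightarrow> ((\<lambda>x. N (f x)) \<longlongrightarrow> N a) F"
  using cont_g cont_T cont_A cont_N
  by (auto intro: isCont_tendsto_compose simp: continuous_on_eq_continuous_at)

lemma continuous_g [continuous_intros]:
  "continuous_on S f \<Longrightarrow> continuous_on S (\<lambda>x. g (f x))"
  and continuous_N [continuous_intros]:
  "continuous_on S f \<Longrightarrow> continuous_on S (\<lambda>x. N (f x))"
  by (rule continuous_on_compose2[OF cont_g]; simp) (rule continuous_on_compose2[OF cont_N]; simp)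

lemma inner_der: "((\<lambda>u. (g u - p) \<bullet> n) has_real_derivative (T t \<bullet> n)) (at t)"
  using bounded_linear.has_vector_derivative[OF bounded_linear_inner_left[of n]
      has_vector_derivative_diff[OF der_g[of t] has_vector_derivative_const[of p]]]
  by (simp add: has_real_derivative_iff_has_vector_derivative)

lemma inner_der2: "((\<lambda>u. T u \<bullet> n) has_real_derivative (A t \<bullet> n)) (at t)"
  using bounded_linear.has_vector_derivative[OF bounded_linear_inner_left[of n] der_T[of t]]
  by (simp add: has_real_derivative_iff_has_vector_derivative)

text \<open>
  The next two lemmas are Taylor's formula in the moving frame at \<open>x\<close>, of first order in the tangential
  and of second order in the normal direction. Together they show that \<open>chord_curv\<close> extends
  continuously to the diagonal: the common factor \<open>(y - x)\<^sup>2\<close> cancels.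
\<close>
lemma chord_tangential:
  obtains s where "\<bar>s - x\<bar> \<le> \<bar>y - x\<bar>" "(g y - g x) \<bullet> T x = (y - x) * (T s \<bullet> T x)"
proof (cases "x = y")
  case True then show ?thesis using that[of x] by simp
next
  case False
  define diff where "diff m = (if m = 0 then \<lambda>u. (g u - g x) \<bullet> T x else (\<lambda>u. T u \<bullet> T x))"
    for m :: nat
  have "\<exists>t. (if y < x then y < t \<and> t < x else x < t \<and> t < y) \<and>
         (g y - g x) \<bullet> T x = (\<Sum>m<1. diff m x / fact m * (y - x) ^ m) +
         diff 1 t / fact 1 * (y - x) ^ 1"
    by (rule Taylor[where a = "min x y" and b = "max x y"])
       (use False in \<open>auto simp: diff_def intro: inner_der\<close>)
  then obtain t where "if y < x then y < t \<and> t < x else x < t \<and> t < y"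
    "(g y - g x) \<bullet> T x = (y - x) * (T t \<bullet> T x)"
    by (auto simp: diff_def mult.commute)
  then show ?thesis using that[of t] by (auto split: if_splits)
qed

lemma chord_normal:
  obtains s where "\<bar>s - x\<bar> \<le> \<bar>y - x\<bar>" "(g y - g x) \<bullet> N x = (y - x)\<^sup>2 / 2 * (A s \<bullet> N x)"
proof (cases "x = y")
  case True then show ?thesis using that[of x] by simp
next
  case False
  define diff where "diff m = (if m = 0 then \<lambda>u. (g u - g x) \<bullet> N x
     else if m = 1 then (\<lambda>u. T u \<bullet> N x) else (\<lambda>u. A u \<bullet> N x))" for m :: nat
  have "\<exists>t. (if y < x then y < t \<and> t < x else x < t \<and> t < y) \<and>
         (g y - g x) \<bullet> N x = (\<Sum>m<2. diff m x / fact m * (y - x) ^ m) +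
         diff 2 t / fact 2 * (y - x) ^ 2"
    by (rule Taylor[where a = "min x y" and b = "max x y"])
       (use False in \<open>auto simp: diff_def less_2_cases_iff intro: inner_der inner_der2\<close>)
  then obtain t where "if y < x then y < t \<and> t < x else x < t \<and> t < y"
    "(g y - g x) \<bullet> N x = (y - x)\<^sup>2 / 2 * (A t \<bullet> N x)"
    by (auto simp: diff_def numeral_2_eq_2 TN)
  then show ?thesis using that[of t] by (auto split: if_splits)
qed

text \<open>
  The three intermediate parameters give a single formula that also covers \<open>y = x\<close> and
  \<open>g y = g x\<close>, where all of them are taken to be \<open>x\<close>; this avoids a case distinction in the limit.
\<close>
lemma chord_curv_near:
  obtains y' s s' where "\<bar>y' - x\<bar> \<le> \<bar>y - x\<bar>" "\<bar>s - x\<bar> \<le> \<bar>y - x\<bar>" "\<bar>s' - x\<bar> \<le> \<bar>y - x\<bar>"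
    "chord_curv x y =
       (A s \<bullet> N x) / ((T s' \<bullet> T x)\<^sup>2 + ((y' - x) / 2)\<^sup>2 * (A s \<bullet> N x)\<^sup>2)"
proof (cases "g y = g x")
  case True
  then show ?thesis using that[of x x x] by (simp add: chord_curv_def TT)
next
  case False
  obtain s where s: "\<bar>s - x\<bar> \<le> \<bar>y - x\<bar>" "(g y - g x) \<bullet> N x = (y - x)\<^sup>2 / 2 * (A s \<bullet> N x)"
    by (rule chord_normal)
  obtain s' where s': "\<bar>s' - x\<bar> \<le> \<bar>y - x\<bar>" "(g y - g x) \<bullet> T x = (y - x) * (T s' \<bullet> T x)"
    by (rule chord_tangential)
  have nz: "(y - x)\<^sup>2 \<noteq> 0" using False by auto
  have "(norm (g y - g x))\<^sup>2 =
      (y - x)\<^sup>2 * ((T s' \<bullet> T x)\<^sup>2 + ((y - x) / 2)\<^sup>2 * (A s \<bullet> N x)\<^sup>2)"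
    unfolding norm_frame[of "g y - g x" x] s(2) s'(2) by (simp add: field_simps power2_eq_square)
  then have "chord_curv x y = ((y - x)\<^sup>2 * (A s \<bullet> N x)) /
     ((y - x)\<^sup>2 * ((T s' \<bullet> T x)\<^sup>2 + ((y - x) / 2)\<^sup>2 * (A s \<bullet> N x)\<^sup>2))"
    unfolding chord_curv_def if_not_P[OF False] s(2) by simp
  also have "\<dots> = (A s \<bullet> N x) / ((T s' \<bullet> T x)\<^sup>2 + ((y - x) / 2)\<^sup>2 * (A s \<bullet> N x)\<^sup>2)"
    using nz by (rule mult_divide_mult_cancel_left)
  finally show ?thesis using that[of y s s'] s(1) s'(1) by simp
qed

lemma chord_curv_tendsto_diagonal:
  assumes x: "X \<longlonglongrightarrow> a" and y: "Y \<longlonglongrightarrow> a"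
  shows "(\<lambda>n. chord_curv (X n) (Y n)) \<longlonglongrightarrow> A a \<bullet> N a"
proof -
  have "\<forall>n. \<exists>y' s s'. \<bar>y' - X n\<bar> \<le> \<bar>Y n - X n\<bar> \<and> \<bar>s - X n\<bar> \<le> \<bar>Y n - X n\<bar> \<and> \<bar>s' - X n\<bar> \<le> \<bar>Y n - X n\<bar>
    \<and> chord_curv (X n) (Y n) =
       (A s \<bullet> N (X n)) / ((T s' \<bullet> T (X n))\<^sup>2 + ((y' - X n) / 2)\<^sup>2 * (A s \<bullet> N (X n))\<^sup>2)"
    using chord_curv_near by metis
  then obtain Z S S' where *: "\<And>n. \<bar>Z n - X n\<bar> \<le> \<bar>Y n - X n\<bar>" "\<And>n. \<bar>S n - X n\<bar> \<le> \<bar>Y n - X n\<bar>"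
      "\<And>n. \<bar>S' n - X n\<bar> \<le> \<bar>Y n - X n\<bar>"
    and eq: "\<And>n. chord_curv (X n) (Y n) =
       (A (S n) \<bullet> N (X n)) / ((T (S' n) \<bullet> T (X n))\<^sup>2 + ((Z n - X n) / 2)\<^sup>2 * (A (S n) \<bullet> N (X n))\<^sup>2)"
    by metis
  have 0: "(\<lambda>n. \<bar>Y n - X n\<bar>) \<longlonglongrightarrow> 0"
    using tendsto_rabs_zero[OF tendsto_diff[OF y x, simplified]] by simp
  have conv: "W \<longlonglongrightarrow> a" if "\<And>n. \<bar>W n - X n\<bar> \<le> \<bar>Y n - X n\<bar>" for W
  proof -
    have "(\<lambda>n. W n - X n) \<longlonglongrightarrow> 0"
      by (rule Lim_null_comparison[OF _ 0]) (simp add: that)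
    from tendsto_add[OF this x] show ?thesis by simp
  qed
  have Z: "Z \<longlonglongrightarrow> a" and S: "S \<longlonglongrightarrow> a" and S': "S' \<longlonglongrightarrow> a" using conv * by auto
  have "(\<lambda>n. (A (S n) \<bullet> N (X n)) / ((T (S' n) \<bullet> T (X n))\<^sup>2 + ((Z n - X n) / 2)\<^sup>2 * (A (S n) \<bullet> N (X n))\<^sup>2))
    \<longlonglongrightarrow> (A a \<bullet> N a) / ((T a \<bullet> T a)\<^sup>2 + ((a - a) / 2)\<^sup>2 * (A a \<bullet> N a)\<^sup>2)"
    by (intro tendsto_intros tendsto_A tendsto_N tendsto_T Z S S' x) (simp_all add: TT)
  then show ?thesis by (simp add: eq TT)
qed

text \<open>
  Where \<open>g b = g a\<close> with \<open>b \<noteq> a\<close>, shifting the second parameter by the period \<open>a - b\<close> reduces the claim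
  to the diagonal.
\<close>
lemma chord_curv_tendsto:
  assumes x: "X \<longlonglongrightarrow> a" and y: "Y \<longlonglongrightarrow> b"
  shows "(\<lambda>n. chord_curv (X n) (Y n)) \<longlonglongrightarrow> chord_curv a b"
proof (cases "g b = g a")
  case True
  have "g (u + (a - b)) = g u" for u using recur[OF True] .
  then have "chord_curv (X n) (Y n + (a - b)) = chord_curv (X n) (Y n)" for n
    by (simp add: chord_curv_def)
  moreover have "(\<lambda>n. chord_curv (X n) (Y n + (a - b))) \<longlonglongrightarrow> A a \<bullet> N a"
    by (rule chord_curv_tendsto_diagonal[OF x]) (use tendsto_add[OF y tendsto_const[of "a - b"]] in simp)
  ultimately show ?thesis using True by (simp add: chord_curv_def)
next
  case False
  have l: "(\<lambda>n. g (Y n) - g (X n)) \<longlonglongrightarrow> g b - g a"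
    by (intro tendsto_diff tendsto_g x y)
  have "\<forall>\<^sub>F n in sequentially. g (Y n) - g (X n) \<noteq> 0"
    by (rule tendsto_imp_eventually_ne[OF l]) (use False in simp)
  then have ev: "\<forall>\<^sub>F n in sequentially.
     2 * ((g (Y n) - g (X n)) \<bullet> N (X n)) / (norm (g (Y n) - g (X n)))\<^sup>2 = chord_curv (X n) (Y n)"
    by eventually_elim (simp add: chord_curv_def)
  have "(\<lambda>n. 2 * ((g (Y n) - g (X n)) \<bullet> N (X n)) / (norm (g (Y n) - g (X n)))\<^sup>2)
     \<longlonglongrightarrow> 2 * ((g b - g a) \<bullet> N a) / (norm (g b - g a))\<^sup>2"
    by (intro tendsto_intros l tendsto_N x) (use False in simp)
  then show ?thesis using ev False by (simp add: chord_curv_def Lim_transform_eventually)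
qed

lemma continuous_chord_curv: "continuous_on UNIV (\<lambda>p. chord_curv (fst p) (snd p))"
  unfolding continuous_on_eq_continuous_at[OF open_UNIV]
  by (intro ballI continuous_at_sequentiallyI chord_curv_tendsto tendsto_fst tendsto_snd)

lemma continuous_chord_curv_right: "continuous_on S (chord_curv x)"
  by (rule continuous_on_compose2[OF continuous_chord_curv, of S "\<lambda>y. (x, y)", simplified])
     (intro continuous_intros)

lemma chord_curv_bounded:
  obtains K where "K > 0" "\<And>x y. x \<in> {a..b} \<Longrightarrow> y \<in> {a..b} \<Longrightarrow> \<bar>chord_curv x y\<bar> \<le> K"
proof -
  have "compact ((\<lambda>p. chord_curv (fst p) (snd p)) ` ({a..b} \<times> {a..b}))"
    by (intro compact_continuous_image continuous_on_subset[OF continuous_chord_curv] compact_Times) auto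
  then obtain K where "K > 0" "\<forall>z\<in>(\<lambda>p. chord_curv (fst p) (snd p)) ` ({a..b} \<times> {a..b}). norm z \<le> K"
    using compact_imp_bounded bounded_pos by metis
  then show ?thesis using that[of K] by force
qed

text \<open>
  A multiple of the power of \<open>p\<close> with respect to the circle of curvature \<open>m\<close> that is tangent to the
  curve at \<open>g t\<close>, normalized so that it stays meaningful for \<open>m = 0\<close>. For \<open>m > 0\<close> it is negative
  exactly inside the disc.
\<close>
definition tangent_disc_power :: "real \<Rightarrow> real \<Rightarrow> complex \<Rightarrow> real" where
  "tangent_disc_power m t p = m * (norm (p - g t))\<^sup>2 - 2 * ((p - g t) \<bullet> N t)"

text \<open>
  A curve point is outside the tangent disc of curvature \<open>m\<close> exactly when its tangent circle has
  curvature at most \<open>m\<close>. Hence a maximum of \<open>chord_curv t\<close> gives a disc free of the curve.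
\<close>
lemma tangent_disc_power_curve:
  "tangent_disc_power m t (g u) = (norm (g u - g t))\<^sup>2 * (m - chord_curv t u)"
  by (cases "g u = g t") (simp_all add: tangent_disc_power_def chord_curv_def right_diff_distrib)

lemma chord_curv_cong: "g u = g v \<Longrightarrow> chord_curv t u = chord_curv t v"
  by (simp add: chord_curv_def)

lemma chord_curv_pos_iff: "g u \<noteq> g t \<Longrightarrow> chord_curv t u > 0 \<longleftrightarrow> (g u - g t) \<bullet> N t > 0"
  by (simp add: chord_curv_def zero_less_divide_iff)

text \<open>
  If the normal at \<open>s\<close> meets the curve again at distance \<open>\<bar>r\<bar>\<close>, the chord is a diameter of the tangent
  circle. As \<open>chord_curv\<close> is bounded on compact sets, short normals of a compact arc therefore miss it;
  this replaces a tubular neighbourhood theorem.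
\<close>
lemma curve_on_normal:
  assumes "g u = g s + r *\<^sub>R N s" "r \<noteq> 0"
  shows "chord_curv s u = 2 / r"
  using assms norm_N[of s] by (auto simp: chord_curv_def NN power2_eq_square)

lemma dist_square_der:
  "((\<lambda>u. (g u - p) \<bullet> (g u - p)) has_real_derivative 2 * ((g t - p) \<bullet> T t)) (at t)"
proof -
  have d: "((\<lambda>u. g u - p) has_derivative (\<lambda>h. h *\<^sub>R T t)) (at t)"
    using has_vector_derivative_diff[OF der_g[of t] has_vector_derivative_const[of p]]
    by (simp add: has_vector_derivative_def)
  show ?thesis
    unfolding has_field_derivative_def
    by (rule has_derivative_eq_rhs[OF has_derivative_inner[OF d d]]) (auto simp: inner_commute)
qed

lemma nearest_point_on_normal:
  assumes "a < s" "s < b" "\<And>u. u \<in> {a..b} \<Longrightarrow> norm (p - g s) \<le> norm (p - g u)"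
  obtains r where "p = g s + r *\<^sub>R N s" "\<bar>r\<bar> = norm (p - g s)"
proof -
  have "(g s - p) \<bullet> (g s - p) \<le> (g u - p) \<bullet> (g u - p)" if "\<bar>s - u\<bar> < min (s - a) (b - s)" for u
  proof -
    have "a \<le> u" "u \<le> b" using that by linarith+
    then have "norm (p - g s) \<le> norm (p - g u)" by (intro assms(3)) simp
    then show ?thesis by (simp add: dot_square_norm norm_minus_commute power_mono)
  qed
  then have "2 * ((g s - p) \<bullet> T s) = 0"
    using assms(1,2) by (intro DERIV_local_min[OF dist_square_der, of "min (s - a) (b - s)"]) auto
  then have "(g s - p) \<bullet> T s = 0" by simp
  then have "(p - g s) \<bullet> T s = 0" by (simp add: inner_diff_left)
  then have "p - g s = ((p - g s) \<bullet> N s) *\<^sub>R N s"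
    using frame_decomposition[of "p - g s" s] by simp
  then show ?thesis using that[of "(p - g s) \<bullet> N s"] norm_N[of s]
    by (metis add.commute diff_add_cancel mult.right_neutral norm_scaleR)
qed

end

section \<open>Loops formed by an arc and its chord\<close>

lemma connected_meets_outside:
  assumes "connected V" "V \<inter> S = {}" "p \<in> V" "p \<in> outside S"
  shows "V \<subseteq> outside S"
proof
  fix q assume "q \<in> V"
  then have "connected_component (- S) p q"
    using assms by (auto simp: connected_component_def)
  then show "q \<in> outside S" using outside_same_component assms(4) by blast
qed

lemma connected_meets_inside:
  assumes "connected V" "V \<inter> S = {}" "p \<in> V" "p \<in> inside S"
  shows "V \<subseteq> inside S"
proof
  fix q assume "q \<in> V"
  then have "connected_component (- S) p q"
    using assms by (auto simp: connected_component_def)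
  then show "q \<in> inside S" using inside_same_component assms(4) by blast
qed

lemma connected_unbounded_outside:
  assumes "connected V" "V \<inter> S = {}" "\<not> bounded V"
  shows "V \<subseteq> outside S"
proof
  fix p assume p: "p \<in> V"
  have "V \<subseteq> connected_component_set (- S) p"
    using p assms by (intro connected_component_maximal) auto
  then have "\<not> bounded (connected_component_set (- S) p)"
    using assms(3) bounded_subset by blast
  then show "p \<in> outside S" using p assms(2) by (auto simp: outside_def)
qed

lemma real_mod_representative:
  fixes a l u :: real
  assumes "l > 0"
  obtains k :: int where "a \<le> u + of_int k * l" "u + of_int k * l < a + l"
proof -
  have "of_int \<lfloor>(u - a) / l\<rfloor> \<le> (u - a) / l" "(u - a) / l < of_int \<lfloor>(u - a) / l\<rfloor> + 1" by linarith+
  then have "of_int \<lfloor>(u - a) / l\<rfloor> * l \<le> u - a" "u - a < (of_int \<lfloor>(u - a) / l\<rfloor> + 1) * l"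
    using assms by (simp_all only: pos_le_divide_eq pos_divide_less_eq)
  then show ?thesis by (intro that[of "- \<lfloor>(u - a) / l\<rfloor>"]) (simp_all add: algebra_simps)
qed

lemma unbounded_ray:
  fixes w :: "'a::real_normed_vector"
  assumes "w \<noteq> 0"
  shows "\<not> bounded ((\<lambda>r. p + r *\<^sub>R w) ` {0<..})"
proof
  assume "bounded ((\<lambda>r. p + r *\<^sub>R w) ` {0<..})"
  then obtain B where B: "\<And>r. r > 0 \<Longrightarrow> norm (p + r *\<^sub>R w) \<le> B"
    unfolding bounded_iff by auto
  define r where "r = (\<bar>B\<bar> + norm p + 1) / norm w"
  have "r > 0" using assms unfolding r_def
    by (intro divide_pos_pos) (simp_all add: add_nonneg_pos)
  have "norm (r *\<^sub>R w) = \<bar>B\<bar> + norm p + 1"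
    using assms by (simp add: r_def)
  moreover have "norm (r *\<^sub>R w) \<le> norm (p + r *\<^sub>R w) + norm p"
    using norm_triangle_ineq4[of "p + r *\<^sub>R w" p] by simp
  ultimately show False using B[OF \<open>r > 0\<close>] by simp
qed

context unit_speed_curve
begin

definition loop :: "real \<Rightarrow> real \<Rightarrow> complex set" where
  "loop a b = g ` {a..b} \<union> closed_segment (g a) (g b)"

text \<open>
  The sign \<open>e\<close> chooses the side of the curve.
\<close>
definition tube :: "real \<Rightarrow> real set \<Rightarrow> real \<Rightarrow> complex set" where
  "tube e S \<rho> = (\<lambda>(s, r). g s + (e * r) *\<^sub>R N s) ` (S \<times> {0<..<\<rho>})"

text \<open>
  Every curve point off the arc can be joined to infinity without meeting the arc. The sets \<open>C\<close> may
  leave the curve only outside its convex hull, so that they miss the chord of the arc whenever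
  the curve does.
\<close>
definition escapes :: "real \<Rightarrow> real \<Rightarrow> bool" where
  "escapes a b \<longleftrightarrow> (\<forall>u. g u \<notin> g ` {a..b} \<longrightarrow>
     (\<exists>C. connected C \<and> \<not> bounded C \<and> g u \<in> C \<and> C \<inter> g ` {a..b} = {} \<and>
          C \<subseteq> range g \<union> - (convex hull range g)))"

lemma norm_minus_normal:
  "(norm (w - r *\<^sub>R N s))\<^sup>2 = (norm w)\<^sup>2 - 2 * r * (w \<bullet> N s) + r\<^sup>2"
  unfolding power2_norm_eq_inner
  by (simp add: inner_diff_left inner_diff_right inner_commute NN power2_eq_square algebra_simps)

lemma connected_tube: "connected S \<Longrightarrow> connected (tube e S \<rho>)"
  unfolding tube_def split_beta
  by (intro connected_continuous_image connected_Times continuous_intros) auto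

lemma loop_simple_closed:
  assumes "a < b" "inj_on g {a..b}" "open_segment (g a) (g b) \<inter> g ` {a..b} = {}"
  obtains h where "simple_path h" "pathfinish h = pathstart h" "path_image h = loop a b"
proof -
  define p where "p = g \<circ> (\<lambda>t. a + t * (b - a))"
  have im: "(\<lambda>t. a + t * (b - a)) ` {0..1} = {a..b}"
  proof (intro equalityI subsetI)
    fix x assume "x \<in> (\<lambda>t. a + t * (b - a)) ` {0..1}"
    then obtain t where t: "0 \<le> t" "t \<le> 1" "x = a + t * (b - a)" by auto
    have "t * (b - a) \<le> 1 * (b - a)" using t assms(1) by (intro mult_right_mono) auto
    moreover have "0 \<le> t * (b - a)" using t assms(1) by simp
    ultimately show "x \<in> {a..b}" unfolding t(3) by simp
  next
    fix x assume "x \<in> {a..b}"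
    then show "x \<in> (\<lambda>t. a + t * (b - a)) ` {0..1}"
      using assms(1) by (intro image_eqI[of _ _ "(x - a) / (b - a)"]) (auto simp: field_simps)
  qed
  have pi: "path_image p = g ` {a..b}"
    unfolding path_image_def p_def image_comp[symmetric] im ..
  have ne: "g a \<noteq> g b" using assms by (auto dest: inj_onD)
  have "inj_on p {0..1}"
    unfolding p_def using assms(1,2) im
    by (intro comp_inj_on) (auto intro!: inj_onI)
  moreover have "path p"
    unfolding path_def p_def comp_def by (intro continuous_intros)
  ultimately have "arc p" by (simp add: arc_def)
  have ps: "pathstart p = g a" "pathfinish p = g b"
    by (simp_all add: p_def pathstart_def pathfinish_def)
  have "simple_path (p +++ linepath (g b) (g a))"
  proof (rule simple_path_join_loop[OF \<open>arc p\<close>])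
    show "arc (linepath (g b) (g a))" using ne by simp
    show "path_image p \<inter> path_image (linepath (g b) (g a)) \<subseteq> {pathstart p, pathstart (linepath (g b) (g a))}"
      using assms(3) by (auto simp: pi ps open_segment_def closed_segment_commute)
  qed (simp_all add: ps)
  then show ?thesis
    by (rule that) (simp_all add: path_image_join ps pi loop_def closed_segment_commute)
qed

end

text \<open>
  The parameter \<open>b\<close> is the point of tangency and \<open>a\<close> the second point of contact. The
  side from which the disc touches at \<open>a\<close> is not known in advance, so the argument at the corner of the
  loop is made at \<open>b\<close>. The margin \<open>\<delta>\<close> beyond \<open>b\<close> is needed to walk along the curve past that corner.
\<close>
locale touching_disc = unit_speed_curve +
  fixes a b \<delta> :: real
  assumes ab: "a < b" and \<delta>: "\<delta> > 0"
    and inj: "inj_on g {a..b+\<delta>}"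
    and pos: "chord_curv b a > 0"
    and maximal: "chord_curv b u \<le> chord_curv b a"
    and escape: "escapes a b"
begin

text \<open>
  The sign of \<open>P\<close> separates the curve (\<open>P \<ge> 0\<close>) from the open chord (\<open>P < 0\<close>).
\<close>
definition P :: "complex \<Rightarrow> real" where "P = tangent_disc_power (chord_curv b a) b"

abbreviation J :: "complex set" where "J \<equiv> loop a b"

lemma P_curve: "P (g u) \<ge> 0"
  unfolding P_def tangent_disc_power_curve using maximal[of u] by simp

lemma P_ends: "P (g a) = 0" "P (g b) = 0"
  unfolding P_def tangent_disc_power_curve by simp_all

lemma P_chord:
  assumes "p = (1 - u) *\<^sub>R g a + u *\<^sub>R g b"
  shows "P p = - (u * (1 - u)) * (chord_curv b a * (norm (g a - g b))\<^sup>2)"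
proof -
  have 1: "chord_curv b a * (norm (g a - g b))\<^sup>2 = 2 * ((g a - g b) \<bullet> N b)"
    using P_ends(1) by (simp add: P_def tangent_disc_power_def)
  have d: "p - g b = (1 - u) *\<^sub>R (g a - g b)" by (simp add: assms algebra_simps)
  have "P p = (1 - u)\<^sup>2 * (chord_curv b a * (norm (g a - g b))\<^sup>2) - (1 - u) * (2 * ((g a - g b) \<bullet> N b))"
    by (simp add: P_def tangent_disc_power_def d power_mult_distrib)
  then show ?thesis unfolding 1[symmetric] by (simp add: power2_eq_square algebra_simps)
qed

lemma g_eq_iff: "s \<in> {a..b+\<delta>} \<Longrightarrow> u \<in> {a..b+\<delta>} \<Longrightarrow> g s = g u \<longleftrightarrow> s = u"
  using inj by (rule inj_on_eq_iff)

lemma ne_ends: "g a \<noteq> g b"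
  using g_eq_iff[of a b] ab \<delta> by auto

lemma P_open_segment: "p \<in> open_segment (g a) (g b) \<Longrightarrow> P p < 0"
  using pos ne_ends by (auto simp: in_segment P_chord)

lemma P_closed_segment: "p \<in> closed_segment (g a) (g b) \<Longrightarrow> P p \<le> 0"
  using pos by (auto simp: in_segment P_chord)

lemma curve_misses_chord: "g u \<notin> open_segment (g a) (g b)"
  using P_open_segment P_curve by (metis not_le)

lemma curve_in_loop_iff: "g u \<in> J \<longleftrightarrow> g u \<in> g ` {a..b}"
  using curve_misses_chord[of u] ab unfolding loop_def open_segment_def by auto

lemma loop_sides:
  shows "inside J \<inter> outside J = {}" "inside J \<union> outside J = - J"
    "frontier (inside J) = J"
proof -
  have "inj_on g {a..b}" using inj \<delta> by (auto elim: inj_on_subset)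
  moreover have "open_segment (g a) (g b) \<inter> g ` {a..b} = {}" using curve_misses_chord by auto
  ultimately obtain h where h: "simple_path h" "pathfinish h = pathstart h" "path_image h = J"
    using loop_simple_closed[OF ab] by metis
  show "inside J \<inter> outside J = {}" "inside J \<union> outside J = - J"
    "frontier (inside J) = J"
    using Jordan_inside_outside[OF h(1,2)] h(3) by auto
qed

lemma rest_outside:
  assumes "g u \<notin> g ` {a..b}"
  shows "g u \<in> outside J"
proof -
  obtain C where C: "connected C" "\<not> bounded C" "g u \<in> C" "C \<inter> g ` {a..b} = {}"
     "C \<subseteq> range g \<union> - (convex hull range g)"
    using escape assms unfolding escapes_def by blast
  have hull: "closed_segment (g a) (g b) \<subseteq> convex hull (range g)"
    by (rule closed_segment_subset) (auto intro: hull_inc)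
  have "q \<notin> closed_segment (g a) (g b)" if q: "q \<in> C" for q
  proof
    assume seg: "q \<in> closed_segment (g a) (g b)"
    obtain v where v: "q = g v" using subsetD[OF C(5) q] subsetD[OF hull seg] by auto
    have "q \<noteq> g a" "q \<noteq> g b" using C(4) ab q by auto
    then show False using curve_misses_chord[of v] seg v by (simp add: open_segment_def)
  qed
  then have "C \<inter> J = {}" using C(4) by (auto simp: loop_def)
  then show ?thesis using connected_unbounded_outside[OF C(1) _ C(2)] C(3) by auto
qed

lemma normals_miss_curve:
  obtains \<rho> where "\<rho> > 0"
    "\<And>s r. s \<in> {a..b+\<delta>} \<Longrightarrow> 0 < \<bar>r\<bar> \<Longrightarrow> \<bar>r\<bar> < \<rho> \<Longrightarrow> g s + r *\<^sub>R N s \<notin> g ` {a..b+\<delta>}"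
proof -
  obtain K where K: "K > 0" "\<And>x y. x \<in> {a..b+\<delta>} \<Longrightarrow> y \<in> {a..b+\<delta>} \<Longrightarrow> \<bar>chord_curv x y\<bar> \<le> K"
    using chord_curv_bounded by metis
  show ?thesis
  proof (rule that[of "2 / K"])
    show "2 / K > 0" using K by simp
    fix s r :: real assume s: "s \<in> {a..b+\<delta>}" and r: "0 < \<bar>r\<bar>" "\<bar>r\<bar> < 2 / K"
    show "g s + r *\<^sub>R N s \<notin> g ` {a..b+\<delta>}"
    proof
      assume "g s + r *\<^sub>R N s \<in> g ` {a..b+\<delta>}"
      then obtain u where u: "u \<in> {a..b+\<delta>}" "g u = g s + r *\<^sub>R N s" by auto
      then have "\<bar>2 / r\<bar> \<le> K" using curve_on_normal[OF u(2)] K(2)[OF s u(1)] r by auto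
      then show False using r K by (simp add: field_simps)
    qed
  qed
qed

lemma distance_to_chord:
  assumes "a < t1" "t2 < b"
  obtains d where "d > 0" "\<And>s q. s \<in> {t1..t2} \<Longrightarrow> q \<in> closed_segment (g a) (g b) \<Longrightarrow> d \<le> dist (g s) q"
proof -
  have "g ` {t1..t2} \<inter> closed_segment (g a) (g b) = {}"
  proof -
    have "g s \<noteq> g a \<and> g s \<noteq> g b" if "s \<in> {t1..t2}" for s
      using g_eq_iff[of s a] g_eq_iff[of s b] that assms ab \<delta> by auto
    then have "g s \<notin> closed_segment (g a) (g b)" if "s \<in> {t1..t2}" for s
      using curve_misses_chord[of s] that by (simp add: open_segment_def)
    then show ?thesis by blast
  qed
  moreover have "compact (g ` {t1..t2})"
    by (intro compact_continuous_image continuous_on_subset[OF cont_g]) auto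
  ultimately obtain d where "d > 0"
    "\<forall>x\<in>g ` {t1..t2}. \<forall>y\<in>closed_segment (g a) (g b). d \<le> dist x y"
    using separate_compact_closed[of "g ` {t1..t2}" "closed_segment (g a) (g b)"] closed_segment by blast
  then show ?thesis by (intro that[of d]) auto
qed

text \<open>
  Near \<open>b\<close> the normals pointing away from the disc leave it at once: along them \<open>P\<close> starts at a value
  that is not negative and increases, because the gradient of \<open>P\<close> at \<open>g b\<close> is \<open>-2 * N b\<close>. So the tube
  on that side can be continued around the corner at \<open>b\<close> without meeting the chord.
\<close>
lemma right_normals_leave_disc:
  obtains \<eta> where "\<eta> > 0" "\<And>s r. \<bar>s - b\<bar> < \<eta> \<Longrightarrow> 0 < r \<Longrightarrow> P (g s - r *\<^sub>R N s) > 0"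
proof -
  define m where "m = chord_curv b a"
  define D where "D s = 2 * m * ((g s - g b) \<bullet> N s) - 2 * (N s \<bullet> N b)" for s
  have id: "((\<lambda>x. x) \<longlongrightarrow> b) (nhds b)" by (rule filterlim_ident)
  have "(D \<longlongrightarrow> D b) (nhds b)"
    unfolding D_def by (intro tendsto_intros tendsto_g tendsto_N id)
  moreover have "D b < 0" by (simp add: D_def NN)
  ultimately have "\<forall>\<^sub>F s in nhds b. D s < 0" by (rule order_tendstoD(2))
  then obtain \<eta> where \<eta>: "\<eta> > 0" "\<And>s. dist s b < \<eta> \<Longrightarrow> D s < 0"
    unfolding eventually_nhds_metric by auto
  have "P (g s - r *\<^sub>R N s) > 0" if "\<bar>s - b\<bar> < \<eta>" "0 < r" for s r
  proof -
    have "P (g s - r *\<^sub>R N s) = P (g s) - r * D s + m * r\<^sup>2"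
    proof -
      have d: "g s - r *\<^sub>R N s - g b = (g s - g b) - r *\<^sub>R N s" by simp
      show ?thesis
        unfolding P_def tangent_disc_power_def D_def m_def d norm_minus_normal
        by (simp add: inner_diff_left algebra_simps)
    qed
    moreover have "r * D s < 0" using \<eta>(2)[of s] that by (simp add: dist_real_def mult_pos_neg)
    moreover have "m * r\<^sup>2 \<ge> 0" using pos by (simp add: m_def)
    ultimately show ?thesis using P_curve[of s] by linarith
  qed
  then show ?thesis using that \<eta>(1) by blast
qed

lemma tube_misses_loop:
  assumes "a < t1" "t2 < b" "e = 1 \<or> e = -1"
  obtains \<rho> where "\<rho> > 0" "tube e {t1..t2} \<rho> \<inter> J = {}"
proof -
  obtain \<rho> where \<rho>: "\<rho> > 0"
    "\<And>s r. s \<in> {a..b+\<delta>} \<Longrightarrow> 0 < \<bar>r\<bar> \<Longrightarrow> \<bar>r\<bar> < \<rho> \<Longrightarrow> g s + r *\<^sub>R N s \<notin> g ` {a..b+\<delta>}"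
    using normals_miss_curve by metis
  obtain d where d: "d > 0" "\<And>s q. s \<in> {t1..t2} \<Longrightarrow> q \<in> closed_segment (g a) (g b) \<Longrightarrow> d \<le> dist (g s) q"
    using distance_to_chord[OF assms(1,2)] by metis
  have "g s + (e * r) *\<^sub>R N s \<notin> J" if "s \<in> {t1..t2}" "0 < r" "r < min \<rho> d" for s r
  proof -
    have e: "\<bar>e * r\<bar> = r" using assms(3) that by auto
    have "g s + (e * r) *\<^sub>R N s \<notin> g ` {a..b+\<delta>}"
      by (rule \<rho>(2)) (use e that assms \<delta> in auto)
    moreover have "dist (g s) (g s + (e * r) *\<^sub>R N s) = r"
      using e by (simp add: dist_norm norm_N)
    then have "g s + (e * r) *\<^sub>R N s \<notin> closed_segment (g a) (g b)"
      using d(2)[OF that(1), of "g s + (e * r) *\<^sub>R N s"] that(3) by auto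
    ultimately show ?thesis using \<delta> unfolding loop_def by auto
  qed
  then show ?thesis using that[of "min \<rho> d"] \<rho>(1) d(1) by (force simp: tube_def)
qed

text \<open>
  The tube on the side opposite to the normal, continued a little past \<open>b\<close>, has in its closure a curve
  point beyond \<open>b\<close>. That point is outside the loop, hence so is the connected tube.
\<close>
lemma right_tube_outside:
  assumes "a < t1" "t1 < b"
  obtains \<rho> where "\<rho> > 0" "tube (-1) {t1..b} \<rho> \<subseteq> outside J"
proof -
  obtain \<eta> where \<eta>: "\<eta> > 0" "\<And>s r. \<bar>s - b\<bar> < \<eta> \<Longrightarrow> 0 < r \<Longrightarrow> P (g s - r *\<^sub>R N s) > 0"
    using right_normals_leave_disc by metis
  define \<eta>' where "\<eta>' = min \<eta> \<delta> / 2"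
  have \<eta>': "\<eta>' > 0" "\<eta>' < \<eta>" "\<eta>' < \<delta>" using \<eta>(1) \<delta> by (auto simp: \<eta>'_def)
  obtain \<rho> where \<rho>: "\<rho> > 0"
    "\<And>s r. s \<in> {a..b+\<delta>} \<Longrightarrow> 0 < \<bar>r\<bar> \<Longrightarrow> \<bar>r\<bar> < \<rho> \<Longrightarrow> g s + r *\<^sub>R N s \<notin> g ` {a..b+\<delta>}"
    using normals_miss_curve by metis
  obtain \<rho>' where \<rho>': "\<rho>' > 0" "tube (-1) {t1..b-\<eta>'} \<rho>' \<inter> J = {}"
    using tube_misses_loop[OF assms(1), of "b - \<eta>'" "-1"] \<eta>' by auto
  define R where "R = min \<rho> \<rho>'"
  have R: "R > 0" "R \<le> \<rho>" "R \<le> \<rho>'" using \<rho> \<rho>' by (auto simp: R_def)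
  \<comment> \<open>Up to \<open>b - \<eta>'\<close> the tube is kept off the chord by the distance to it, from there on by the sign
    of \<open>P\<close>.\<close>
  let ?V = "tube (-1) {t1..b+\<eta>'} R"
  have "g s - r *\<^sub>R N s \<notin> J" if s: "s \<in> {t1..b+\<eta>'}" and r: "0 < r" "r < R" for s r
  proof (cases "s \<le> b - \<eta>'")
    case True
    then have "g s - r *\<^sub>R N s \<in> tube (-1) {t1..b-\<eta>'} \<rho>'"
      using s r R unfolding tube_def by (intro image_eqI[of _ _ "(s, r)"]) auto
    then show ?thesis using \<rho>'(2) by auto
  next
    case False
    then have "P (g s - r *\<^sub>R N s) > 0" using s r \<eta>' by (intro \<eta>(2)) auto
    then have "g s - r *\<^sub>R N s \<notin> closed_segment (g a) (g b)"
      using P_closed_segment by (meson not_less)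
    moreover have "g s + (- r) *\<^sub>R N s \<notin> g ` {a..b+\<delta>}"
      by (rule \<rho>(2)) (use s r R \<eta>' assms in auto)
    ultimately show ?thesis using \<delta> by (auto simp: loop_def)
  qed
  then have VJ: "?V \<inter> J = {}" by (auto simp: tube_def)
  have Vc: "connected ?V" by (intro connected_tube) simp
  let ?q = "g (b + \<eta>')"
  have "?q \<in> closure ?V"
    unfolding closure_approachable
  proof (intro allI impI)
    fix e :: real assume "e > 0"
    define r where "r = min R e / 2"
    have r: "r > 0" "r < R" "r < e" using \<open>e > 0\<close> R by (auto simp: r_def)
    have "g (b + \<eta>') + (-1 * r) *\<^sub>R N (b + \<eta>') \<in> ?V"
      using r assms \<eta>' unfolding tube_def by (intro image_eqI[of _ _ "(b + \<eta>', r)"]) auto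
    moreover have "dist (g (b + \<eta>') + (-1 * r) *\<^sub>R N (b + \<eta>')) ?q < e"
      using r by (simp add: dist_norm norm_N)
    ultimately show "\<exists>y\<in>?V. dist y ?q < e" by blast
  qed
  then have c: "connected (insert ?q ?V)"
    by (intro connected_intermediate_closure[OF Vc]) (auto simp: closure_def)
  have "?q \<notin> g ` {a..b}"
  proof
    assume "?q \<in> g ` {a..b}"
    then obtain u where "u \<in> {a..b}" "?q = g u" by auto
    then show False using g_eq_iff[of "b + \<eta>'" u] \<eta>' ab by auto
  qed
  then have q: "?q \<in> outside J" "?q \<notin> J" using rest_outside curve_in_loop_iff by auto
  have "insert ?q ?V \<subseteq> outside J"
    by (rule connected_meets_outside[OF c _ _ q(1)]) (use VJ q in auto)
  moreover have "tube (-1) {t1..b} R \<subseteq> ?V" using \<eta>' unfolding tube_def by (intro image_mono) auto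
  ultimately show ?thesis using that[OF R(1)] by auto
qed

text \<open>
  Every point of the loop is a limit of inside points. An inside point near \<open>g t\<close> lies on the normal
  through its nearest point of the arc, and not on the outer side, so it lies in the tube on the other
  side. That tube is connected and misses the loop, hence is inside.
\<close>
lemma left_side_inside:
  assumes "a < t" "t < b"
  obtains \<rho> where "\<rho> > 0" "\<And>r. 0 < r \<Longrightarrow> r < \<rho> \<Longrightarrow> g t + r *\<^sub>R N t \<in> inside J"
proof -
  define t1 where "t1 = (a + t) / 2"
  define t2 where "t2 = (t + b) / 2"
  have t: "a < t1" "t1 < t" "t < t2" "t2 < b" using assms by (auto simp: t1_def t2_def)
  obtain \<rho>1 where \<rho>1: "\<rho>1 > 0" "tube (-1) {t1..b} \<rho>1 \<subseteq> outside J"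
    using right_tube_outside[of t1] t by auto
  obtain \<rho>2 where \<rho>2: "\<rho>2 > 0" "tube 1 {t1..t2} \<rho>2 \<inter> J = {}"
    using tube_misses_loop[of t1 t2 1] t by auto
  have "\<exists>d>0. \<forall>x\<in>{g t}. \<forall>y\<in>g ` ({a..t1} \<union> {t2..b}). d \<le> dist x y"
  proof (rule separate_compact_closed)
    show "closed (g ` ({a..t1} \<union> {t2..b}))"
      by (intro compact_imp_closed compact_continuous_image continuous_on_subset[OF cont_g]) auto
    show "{g t} \<inter> g ` ({a..t1} \<union> {t2..b}) = {}"
    proof -
      have "g t \<noteq> g u" if "u \<in> {a..t1} \<union> {t2..b}" for u
        using g_eq_iff[of t u] that t \<delta> by auto
      then show ?thesis by blast
    qed
  qed simp
  then obtain d where d: "d > 0" "\<And>u. u \<in> {a..t1} \<union> {t2..b} \<Longrightarrow> d \<le> dist (g t) (g u)"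
    by auto
  \<comment> \<open>A point within \<open>e\<close> of \<open>g t\<close> has its nearest point of the arc within \<open>2 * e\<close> of \<open>g t\<close>,
    so at a parameter between \<open>t1\<close> and \<open>t2\<close>.\<close>
  define e where "e = min (d / 2) (min \<rho>1 \<rho>2)"
  have e: "e > 0" "2 * e \<le> d" "e \<le> \<rho>1" "e \<le> \<rho>2" using d \<rho>1 \<rho>2 by (auto simp: e_def)
  have "g t \<in> frontier (inside J)" using assms loop_sides(3) by (auto simp: loop_def)
  then have "g t \<in> closure (inside J)" by (simp add: frontier_def)
  then obtain p where p: "p \<in> inside J" "dist p (g t) < e"
    using e(1) unfolding closure_approachable by blast
  have "\<exists>s\<in>{a..b}. \<forall>u\<in>{a..b}. norm (p - g s) \<le> norm (p - g u)"
    using ab by (intro continuous_attains_inf continuous_intros) auto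
  then obtain s where s: "s \<in> {a..b}" "\<And>u. u \<in> {a..b} \<Longrightarrow> norm (p - g s) \<le> norm (p - g u)"
    by auto
  have sd: "norm (p - g s) < e"
    using s(2)[of t] p(2) assms by (simp add: dist_norm)
  have "dist (g t) (g s) < 2 * e"
    using dist_triangle[of "g t" "g s" p] sd p(2) by (simp add: dist_norm norm_minus_commute)
  then have "s \<notin> {a..t1} \<union> {t2..b}" using d(2)[of s] e by auto
  then have s12: "t1 < s" "s < t2" using s(1) by auto
  obtain r where r: "p = g s + r *\<^sub>R N s" "\<bar>r\<bar> = norm (p - g s)"
    using nearest_point_on_normal[of a s b p] s t s12 by auto
  have "p \<notin> J" using p(1) by (auto simp: inside_def)
  then have "r \<noteq> 0" using r(1) s(1) by (auto simp: loop_def)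
  moreover have "\<not> r < 0"
  proof
    assume "r < 0"
    then have "p \<in> tube (-1) {t1..b} \<rho>1"
      using r s12 t sd e unfolding tube_def by (intro image_eqI[of _ _ "(s, -r)"]) auto
    then show False using \<rho>1(2) p(1) loop_sides(1) by blast
  qed
  ultimately have "r > 0" by simp
  then have "p \<in> tube 1 {t1..t2} \<rho>2"
    using r s12 sd e unfolding tube_def by (intro image_eqI[of _ _ "(s, r)"]) auto
  then have in2: "tube 1 {t1..t2} \<rho>2 \<subseteq> inside J"
    by (intro connected_meets_inside[OF connected_tube \<rho>2(2) _ p(1)]) auto
  have "g t + r *\<^sub>R N t \<in> inside J" if "0 < r" "r < \<rho>2" for r
  proof -
    have "g t + r *\<^sub>R N t \<in> tube 1 {t1..t2} \<rho>2"
      using that t unfolding tube_def by (intro image_eqI[of _ _ "(t, r)"]) auto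
    then show ?thesis using in2 by auto
  qed
  then show ?thesis using that \<rho>2(1) by blast
qed

text \<open>
  A small disc tangent at \<open>g t\<close> is inside the loop. Unlike the normal segment, it contains the initial
  piece of every segment that starts at \<open>g t\<close> towards that side.
\<close>
lemma disc_inside:
  assumes "a < t" "t < b"
  obtains R where "R > 0" "ball (g t + R *\<^sub>R N t) R \<subseteq> inside J"
proof -
  obtain K where K: "K > 0" "\<And>x y. x \<in> {a..b} \<Longrightarrow> y \<in> {a..b} \<Longrightarrow> \<bar>chord_curv x y\<bar> \<le> K"
    using chord_curv_bounded by metis
  obtain d where d: "d > 0" "\<And>s q. s \<in> {t..t} \<Longrightarrow> q \<in> closed_segment (g a) (g b) \<Longrightarrow> d \<le> dist (g s) q"
    using distance_to_chord[OF assms] by metis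
  \<comment> \<open>Curvature at least \<open>K\<close> keeps the disc off the arc, diameter at most \<open>d\<close> off the chord.\<close>
  define R where "R = min (1 / K) (d / 2)"
  have R: "R > 0" "R \<le> 1 / K" "2 * R \<le> d" using K(1) d(1) by (auto simp: R_def)
  let ?B = "ball (g t + R *\<^sub>R N t) R"
  have "p \<notin> J" if p: "p \<in> ?B" for p
  proof
    assume "p \<in> J"
    then consider v where "v \<in> {a..b}" "p = g v" | "p \<in> closed_segment (g a) (g b)"
      by (auto simp: loop_def)
    then show False
    proof cases
      case 1
      have "(norm (g v - g t - R *\<^sub>R N t))\<^sup>2 < R\<^sup>2"
        using p R(1)
        by (intro power_strict_mono) (auto simp: 1 dist_norm norm_minus_commute diff_diff_eq)
      then have "(norm (g v - g t))\<^sup>2 < 2 * R * ((g v - g t) \<bullet> N t)"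
        unfolding norm_minus_normal by simp
      moreover have "chord_curv t v * (norm (g v - g t))\<^sup>2 = 2 * ((g v - g t) \<bullet> N t)"
        by (cases "g v = g t") (simp_all add: chord_curv_def)
      then have "2 * R * ((g v - g t) \<bullet> N t) = (R * chord_curv t v) * (norm (g v - g t))\<^sup>2"
        by simp
      ultimately have lt: "(norm (g v - g t))\<^sup>2 < (R * chord_curv t v) * (norm (g v - g t))\<^sup>2"
        by simp
      have "R * chord_curv t v \<le> 1 / K * K"
      proof -
        have "R * chord_curv t v \<le> R * K"
          using K(2)[of t v] 1 assms R by (intro mult_left_mono) auto
        also have "\<dots> \<le> 1 / K * K" using R K(1) by (intro mult_right_mono) auto
        finally show ?thesis .
      qed
      then have "R * chord_curv t v \<le> 1" using K(1) by simp
      then show False using lt mult_right_mono[of "R * chord_curv t v" 1 "(norm (g v - g t))\<^sup>2"] by simp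
    next
      case 2
      have "dist (g t) (g t + R *\<^sub>R N t) = R" using R(1) by (simp add: dist_norm norm_N)
      then have "dist (g t) p < 2 * R"
        using p dist_triangle[of "g t" p "g t + R *\<^sub>R N t"] by simp
      then show False using d(2)[of t p] 2 R by simp
    qed
  qed
  then have disj: "?B \<inter> J = {}" by auto
  obtain \<rho> where \<rho>: "\<rho> > 0" "\<And>r. 0 < r \<Longrightarrow> r < \<rho> \<Longrightarrow> g t + r *\<^sub>R N t \<in> inside J"
    using left_side_inside[OF assms] by metis
  define r where "r = min R \<rho> / 2"
  have r: "r > 0" "r < R" "r < \<rho>" using R \<rho> by (auto simp: r_def)
  have "g t + r *\<^sub>R N t \<in> ?B"
  proof -
    have "dist (g t + R *\<^sub>R N t) (g t + r *\<^sub>R N t) = norm ((R - r) *\<^sub>R N t)"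
      by (simp add: dist_norm algebra_simps)
    then show ?thesis using r by (simp add: norm_N)
  qed
  then have "?B \<subseteq> inside J"
    using connected_meets_inside[OF _ disj _ \<rho>(2)[OF r(1,3)]] by auto
  then show ?thesis using that R(1) by blast
qed

end

section \<open>Trapped discs\<close>

context unit_speed_curve
begin

definition touching_pair :: "real \<Rightarrow> real \<Rightarrow> bool" where
  "touching_pair x y \<longleftrightarrow> chord_curv x y > 0 \<and> (\<forall>u. chord_curv x u \<le> chord_curv x y)"

text \<open>
  With equal coefficients of the quadratic term, two powers differ by an affine function: its zero set
  is the radical axis of the two circles.
\<close>
lemma power_difference_affine:
  fixes e m s t :: real
  defines "h \<equiv> \<lambda>z. e * tangent_disc_power m s z - m * tangent_disc_power e t z"
  shows "h ((1 - x) *\<^sub>R p + x *\<^sub>R q) = (1 - x) * h p + x * h q"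
proof -
  define V where "V = (2 * e * m) *\<^sub>R (g t - g s) - (2 * e) *\<^sub>R N s + (2 * m) *\<^sub>R N t"
  define C where "C = e * m * (g s \<bullet> g s - g t \<bullet> g t) + 2 * e * (g s \<bullet> N s) - 2 * m * (g t \<bullet> N t)"
  have h: "h z = z \<bullet> V + C" for z
    unfolding h_def tangent_disc_power_def power2_norm_eq_inner V_def C_def
    by (simp add: inner_diff_left inner_diff_right inner_add_right inner_commute algebra_simps)
  show ?thesis
    unfolding h by (simp add: inner_add_left algebra_simps)
qed

end

context touching_disc
begin

text \<open>
  Otherwise the loop would lie in the half plane behind the tangent at \<open>t\<close>, and the normal ray from
  \<open>g t\<close> would lead from the inside of the loop to infinity.
\<close>
lemma trapped_positive:
  assumes t: "a < t" "t < b"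
  shows "\<exists>v\<in>{a..b}. chord_curv t v > 0"
proof (rule ccontr)
  assume "\<not> (\<exists>v\<in>{a..b}. chord_curv t v > 0)"
  then have le: "(g v - g t) \<bullet> N t \<le> 0" if "v \<in> {a..b}" for v
    using that chord_curv_pos_iff[of v t] by (cases "g v = g t") (force simp: not_less)+
  have J_le: "(q - g t) \<bullet> N t \<le> 0" if "q \<in> J" for q
  proof -
    from that consider v where "v \<in> {a..b}" "q = g v" | "q \<in> closed_segment (g a) (g b)"
      by (auto simp: loop_def)
    then show ?thesis
    proof cases
      case 1
      then show ?thesis using le by simp
    next
      case 2
      then obtain x where x: "0 \<le> x" "x \<le> 1" "q = (1 - x) *\<^sub>R g a + x *\<^sub>R g b"
        by (auto simp: in_segment)
      have "(q - g t) \<bullet> N t = (1 - x) * ((g a - g t) \<bullet> N t) + x * ((g b - g t) \<bullet> N t)"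
        by (simp add: x(3) inner_diff_left inner_add_left algebra_simps)
      moreover have "(1 - x) * ((g a - g t) \<bullet> N t) \<le> 0" "x * ((g b - g t) \<bullet> N t) \<le> 0"
        using le[of a] le[of b] ab x by (auto intro: mult_nonneg_nonpos)
      ultimately show ?thesis by linarith
    qed
  qed
  let ?C = "(\<lambda>r. g t + r *\<^sub>R N t) ` {0<..}"
  have disj: "?C \<inter> J = {}"
  proof -
    have "g t + r *\<^sub>R N t \<notin> J" if "r > 0" for r
      using J_le[of "g t + r *\<^sub>R N t"] that by (auto simp: NN)
    then show ?thesis by auto
  qed
  have "connected ?C" by (intro connected_continuous_image continuous_intros) auto
  moreover have "\<not> bounded ?C" using norm_N[of t] by (intro unbounded_ray) auto
  ultimately have out: "?C \<subseteq> outside J" using disj by (intro connected_unbounded_outside)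
  obtain \<rho> where "\<rho> > 0" "\<And>r. 0 < r \<Longrightarrow> r < \<rho> \<Longrightarrow> g t + r *\<^sub>R N t \<in> inside J"
    using left_side_inside[OF t] by metis
  then have "g t + (\<rho> / 2) *\<^sub>R N t \<in> inside J" "g t + (\<rho> / 2) *\<^sub>R N t \<in> ?C" by auto
  then show False using out loop_sides(1) by blast
qed

text \<open>
  Suppose that a curve point \<open>g u\<close> off the arc had a tangent circle of larger curvature \<open>e\<close> at \<open>t\<close>. The
  disc of that circle contains no point of the arc, so the segment from \<open>g t\<close> to \<open>g u\<close>, a chord of
  it, misses the arc. It also misses the chord of the loop: the end points of each chord lie outside
  the disc of the other, so the two chords lie on different sides of the radical axis. Hence the
  segment joins the inside of the loop to the outside without meeting the loop.
\<close>
lemma trapped_global: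
  assumes t: "a < t" "t < b"
    and v: "chord_curv t v > 0" "\<And>w. w \<in> {a..b} \<Longrightarrow> chord_curv t w \<le> chord_curv t v"
  shows "chord_curv t u \<le> chord_curv t v"
proof (rule ccontr)
  define e where "e = chord_curv t u"
  define m where "m = chord_curv b a"
  define d where "d = g u - g t"
  assume "\<not> chord_curv t u \<le> chord_curv t v"
  then have e: "e > 0" "\<And>w. w \<in> {a..b} \<Longrightarrow> chord_curv t w < e"
    using v by (force simp: e_def)+
  have gu: "g u \<notin> g ` {a..b}"
    using e(2) chord_curv_cong[of u _ t] by (force simp: e_def)
  have d0: "d \<noteq> 0" using gu t by (auto simp: d_def)
  have m: "m > 0" using pos by (simp add: m_def)
  let ?E = "tangent_disc_power e t"
  define h where "h z = e * P z - m * ?E z" for z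
  have h_affine: "h ((1 - x) *\<^sub>R p + x *\<^sub>R q) = (1 - x) * h p + x * h q" for x p q
    unfolding h_def P_def m_def by (rule power_difference_affine)
  have E_ends: "?E (g t) = 0" "?E (g u) = 0" by (simp_all add: tangent_disc_power_curve e_def)
  have E_pos: "?E (g w) > 0" if "w \<in> {a..b}" "g w \<noteq> g t" for w
    using e(2)[OF that(1)] that(2) by (simp add: tangent_disc_power_curve)
  let ?S = "(\<lambda>x. g t + x *\<^sub>R d) ` {0<..1}"
  \<comment> \<open>Off the arc by the sign of \<open>?E\<close>, off the chord by the sign of the affine function \<open>h\<close>.\<close>
  have off: "g t + x *\<^sub>R d \<notin> J" if x: "0 < x" "x \<le> 1" for x
  proof
    define q where "q = g t + x *\<^sub>R d"
    have q: "q = (1 - x) *\<^sub>R g t + x *\<^sub>R g u" by (simp add: q_def d_def algebra_simps)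
    assume "g t + x *\<^sub>R d \<in> J"
    then consider w where "w \<in> {a..b}" "q = g w" | "q \<in> closed_segment (g a) (g b)"
      by (auto simp: loop_def q_def)
    then show False
    proof cases
      case 1
      have "?E q = x\<^sup>2 * (e * (norm d)\<^sup>2) - x * (2 * (d \<bullet> N t))"
        by (simp add: tangent_disc_power_def q_def power_mult_distrib)
      also have "2 * (d \<bullet> N t) = e * (norm d)\<^sup>2"
        using E_ends(2) by (simp add: tangent_disc_power_def d_def)
      also have "x\<^sup>2 * (e * (norm d)\<^sup>2) - x * (e * (norm d)\<^sup>2) = - (x * (1 - x) * (e * (norm d)\<^sup>2))"
        by (simp add: power2_eq_square algebra_simps)
      also have "\<dots> \<le> 0" using x e(1) by simp
      finally have "?E (g w) \<le> 0" using 1 by simp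
      moreover have "g w \<noteq> g t" using 1(2) x d0 by (auto simp: q_def)
      ultimately show False using E_pos[OF 1(1)] by simp
    next
      case 2
      then obtain y where y: "0 \<le> y" "y \<le> 1" "q = (1 - y) *\<^sub>R g a + y *\<^sub>R g b"
        by (auto simp: in_segment)
      have "h (g t) \<ge> 0" "h (g u) \<ge> 0" using e(1) P_curve by (simp_all add: h_def E_ends)
      then have "h q \<ge> 0" using x by (simp add: q h_affine)
      moreover have "h q < 0"
      proof -
        have "h (g a) < 0" "h (g b) < 0"
          using E_pos[of a] E_pos[of b] g_eq_iff[of a t] g_eq_iff[of b t] ab t m \<delta>
          by (simp_all add: h_def P_ends)
        then show ?thesis
          unfolding y(3) h_affine using y(1,2) convex_bound_lt[of "h (g a)" 0 "h (g b)" "1 - y" y] by simp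
      qed
      ultimately show False by simp
    qed
  qed
  then have disj: "?S \<inter> J = {}" by auto
  have "connected ?S" by (intro connected_continuous_image continuous_intros) auto
  moreover have "g u \<in> ?S" by (intro image_eqI[of _ _ 1]) (auto simp: d_def)
  ultimately have out: "?S \<subseteq> outside J"
    using disj rest_outside[OF gu] by (intro connected_meets_outside)
  obtain R where R: "R > 0" "ball (g t + R *\<^sub>R N t) R \<subseteq> inside J"
    using disc_inside[OF t] by metis
  \<comment> \<open>The segment runs inside the disc of curvature \<open>1 / R\<close> for parameters below \<open>R * e\<close>, the ratio
    of the radius of this disc to that of the disc of curvature \<open>e\<close>.\<close>
  define x where "x = min 1 (R * e / 2)"
  have x: "0 < x" "x \<le> 1" "x < R * e" using R(1) e(1) by (auto simp: x_def min_def)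
  have "(norm (x *\<^sub>R d - R *\<^sub>R N t))\<^sup>2 = x * (x * (norm d)\<^sup>2 - R * (2 * (d \<bullet> N t))) + R\<^sup>2"
    unfolding norm_minus_normal by (simp add: power_mult_distrib power2_eq_square algebra_simps)
  also have "2 * (d \<bullet> N t) = e * (norm d)\<^sup>2"
    using E_ends(2) by (simp add: tangent_disc_power_def d_def)
  also have "x * (x * (norm d)\<^sup>2 - R * (e * (norm d)\<^sup>2)) + R\<^sup>2 < R\<^sup>2"
  proof -
    have "x * (norm d)\<^sup>2 < R * e * (norm d)\<^sup>2" using x d0 by (intro mult_strict_right_mono) auto
    then have "x * (norm d)\<^sup>2 - R * (e * (norm d)\<^sup>2) < 0" by (simp add: mult.assoc)
    then show ?thesis using x(1) by (simp add: mult_pos_neg)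
  qed
  finally have "norm (x *\<^sub>R d - R *\<^sub>R N t) < R" using R(1) by (simp add: power2_less_imp_less)
  then have "g t + x *\<^sub>R d \<in> ball (g t + R *\<^sub>R N t) R"
    by (simp add: dist_norm norm_minus_commute)
  moreover have "g t + x *\<^sub>R d \<in> ?S" using x by auto
  ultimately show False using R(2) out loop_sides(1) by blast
qed

lemma trapped:
  assumes t: "a < t" "t < b"
  shows "\<exists>v\<in>{a..b}. touching_pair t v"
proof -
  have "\<exists>v\<in>{a..b}. \<forall>w\<in>{a..b}. chord_curv t w \<le> chord_curv t v"
    using ab by (intro continuous_attains_sup continuous_chord_curv_right) auto
  then obtain v where v: "v \<in> {a..b}" "\<And>w. w \<in> {a..b} \<Longrightarrow> chord_curv t w \<le> chord_curv t v" by auto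
  have "chord_curv t v > 0" using trapped_positive[OF t] v(2) by (meson order_less_le_trans)
  then show ?thesis using v trapped_global[OF t] by (auto simp: touching_pair_def)
qed

end

section \<open>Existence of a vertex\<close>

context unit_speed_curve
begin

lemma halve_right:
  assumes "a < b" "\<delta> > 0" "inj_on g {a..b+\<delta>}" "touching_pair b a" "escapes a b"
  shows "\<exists>v\<in>{a..b}. touching_pair ((a + b) / 2) v"
proof -
  interpret touching_disc g T A c a b \<delta>
    by unfold_locales (use assms in \<open>auto simp: touching_pair_def\<close>)
  show ?thesis using ab by (intro trapped) auto
qed

lemma reversed: "unit_speed_curve (\<lambda>t. g (- t)) (\<lambda>t. - T (- t)) (\<lambda>t. A (- t)) (- c)"
proof
  fix t s u
  have *: "(uminus has_vector_derivative - 1) (at t)" for t :: real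
    using has_vector_derivative_minus[OF has_vector_derivative_id, of "at t"] by simp
  show "((\<lambda>t. g (- t)) has_vector_derivative - T (- t)) (at t)"
    using vector_diff_chain_at[OF * der_g, of t] by (simp add: comp_def)
  have "((\<lambda>t. T (- t)) has_vector_derivative - A (- t)) (at t)"
    using vector_diff_chain_at[OF * der_T, of t] by (simp add: comp_def)
  from has_vector_derivative_minus[OF this]
  show "((\<lambda>t. - T (- t)) has_vector_derivative A (- t)) (at t)" by simp
  show "continuous_on UNIV (\<lambda>t. A (- t))"
    by (rule continuous_on_compose2[OF cont_A]) (auto intro: continuous_intros)
  show "norm (- T (- t)) = 1" by (simp add: norm_T)
  show "- c = \<i> \<or> - c = - \<i>" using side by auto
  assume "g (- s) = g (- t)"
  from recur[OF this, of "- u"] show "g (- (u + (t - s))) = g (- u)" by (simp add: algebra_simps)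
qed

lemma halve_left:
  assumes "a < b" "\<delta> > 0" "inj_on g {a-\<delta>..b}" "touching_pair a b" "escapes a b"
  shows "\<exists>v\<in>{a..b}. touching_pair ((a + b) / 2) v"
proof -
  interpret rev: unit_speed_curve "\<lambda>t. g (- t)" "\<lambda>t. - T (- t)" "\<lambda>t. A (- t)" "- c"
    by (rule reversed)
  have "rev.N t = N (- t)" for t by (simp add: rev.N_def N_def)
  then have cc: "rev.chord_curv x y = chord_curv (- x) (- y)" for x y
    by (simp add: rev.chord_curv_def chord_curv_def)
  have tp: "rev.touching_pair x y \<longleftrightarrow> touching_pair (- x) (- y)" for x y
    unfolding rev.touching_pair_def touching_pair_def cc by (metis minus_minus)
  have im: "(\<lambda>t. g (- t)) ` S = g ` uminus ` S" for S by (simp add: image_image)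
  have r: "range (\<lambda>t. g (- t)) = range g" unfolding im by simp
  have esc: "rev.escapes (- b) (- a)"
    using assms(5) unfolding rev.escapes_def escapes_def r im by simp
  have "inj_on (\<lambda>t. g (- t)) {- b..- a + \<delta>}"
    by (rule inj_onI) (use inj_onD[OF assms(3)] in force)
  then have "\<exists>v\<in>{- b..- a}. rev.touching_pair ((- b + - a) / 2) v"
    using assms esc by (intro rev.halve_right) (auto simp: tp)
  then obtain v where v: "v \<in> {- b..- a}" "touching_pair (- ((- b + - a) / 2)) (- v)"
    by (auto simp: tp)
  moreover have "- ((- b + - a) / 2) = (a + b) / 2" by (simp add: field_simps)
  ultimately have "touching_pair ((a + b) / 2) (- v)" by metis
  then show ?thesis using v(1) by (intro bexI[of _ "- v"]) auto
qed

lemma touching_pair_limit: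
  assumes ab: "\<And>n. X n \<in> {a..b}" and tp: "\<And>n. touching_pair (X n) (Y n)"
    and lim: "(\<lambda>n. X n - Y n) \<longlonglongrightarrow> 0"
  shows "\<exists>z. \<forall>u. chord_curv z u \<le> chord_curv z z"
proof -
  obtain z r where r: "strict_mono r" "(X \<circ> r) \<longlonglongrightarrow> z"
    using compact_Icc[of a b] ab unfolding compact_def by metis
  have X: "(\<lambda>n. X (r n)) \<longlonglongrightarrow> z" using r(2) by (simp add: comp_def)
  have "(\<lambda>n. X (r n) - Y (r n)) \<longlonglongrightarrow> 0"
    using LIMSEQ_subseq_LIMSEQ[OF lim r(1)] by (simp add: comp_def)
  from tendsto_diff[OF X this] have Y: "(\<lambda>n. Y (r n)) \<longlonglongrightarrow> z" by simp
  have "chord_curv z u \<le> chord_curv z z" for u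
  proof (rule LIMSEQ_le)
    show "(\<lambda>n. chord_curv (X (r n)) u) \<longlonglongrightarrow> chord_curv z u"
      by (intro chord_curv_tendsto X) simp
    show "(\<lambda>n. chord_curv (X (r n)) (Y (r n))) \<longlonglongrightarrow> chord_curv z z"
      by (intro chord_curv_tendsto X Y)
    show "\<exists>N. \<forall>n\<ge>N. chord_curv (X (r n)) u \<le> chord_curv (X (r n)) (Y (r n))"
      using tp by (auto simp: touching_pair_def)
  qed
  then show ?thesis by blast
qed

text \<open>
  In the absence of a vertex the second point of a touching pair never coincides with the first, so
  the halving step can be repeated indefinitely, and the limit would be a vertex after all.
\<close>
lemma vertex_between:
  assumes "a0 < b0" "\<delta> > 0" "inj_on g {a0-\<delta>..b0+\<delta>}"
    and esc: "\<And>a b. a0 \<le> a \<Longrightarrow> a < b \<Longrightarrow> b \<le> b0 \<Longrightarrow> escapes a b"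
    and start: "touching_pair a0 b0 \<or> touching_pair b0 a0"
  shows "\<exists>z. \<forall>u. chord_curv z u \<le> chord_curv z z"
proof (rule ccontr)
  assume no: "\<not> ?thesis"
  have "\<exists>x y. x \<in> {a0..b0} \<and> y \<in> {a0..b0} \<and> \<bar>x - y\<bar> \<le> (b0 - a0) / 2 ^ n \<and> touching_pair x y" for n
  proof (induction n)
    case 0
    show ?case using start
    proof
      assume "touching_pair a0 b0"
      then show ?thesis using assms(1) by (intro exI[of _ a0] exI[of _ b0]) auto
    next
      assume "touching_pair b0 a0"
      then show ?thesis using assms(1) by (intro exI[of _ b0] exI[of _ a0]) auto
    qed
  next
    case (Suc n)
    then obtain x y where xy: "x \<in> {a0..b0}" "y \<in> {a0..b0}" "\<bar>x - y\<bar> \<le> (b0 - a0) / 2 ^ n"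
      "touching_pair x y" by blast
    have "x \<noteq> y" using no xy(4) by (auto simp: touching_pair_def)
    define a where "a = min x y"
    define b where "b = max x y"
    have ab: "a < b" "a0 \<le> a" "b \<le> b0" "b - a = \<bar>x - y\<bar>"
      using xy \<open>x \<noteq> y\<close> by (auto simp: a_def b_def)
    have "\<exists>v\<in>{a..b}. touching_pair ((a + b) / 2) v"
    proof (cases "x < y")
      case True
      then show ?thesis using xy ab assms(2) esc[of a b]
        by (intro halve_left[of a b \<delta>] inj_on_subset[OF assms(3)]) (auto simp: a_def b_def)
    next
      case False
      then show ?thesis using xy ab assms(2) esc[of a b] \<open>x \<noteq> y\<close>
        by (intro halve_right[of a b \<delta>] inj_on_subset[OF assms(3)]) (auto simp: a_def b_def)
    qed
    then obtain v where v: "v \<in> {a..b}" "touching_pair ((a + b) / 2) v" by blast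
    have "\<bar>(a + b) / 2 - v\<bar> \<le> (b - a) / 2" using v(1) by (auto simp: abs_le_iff field_simps)
    also have "\<dots> \<le> (b0 - a0) / 2 ^ n / 2" unfolding ab(4) using xy(3) by (rule divide_right_mono) simp
    also have "\<dots> = (b0 - a0) / 2 ^ Suc n" by simp
    finally show ?case using v ab by (intro exI[of _ "(a + b) / 2"] exI[of _ v]) auto
  qed
  then obtain X Y where XY: "\<And>n. X n \<in> {a0..b0}" "\<And>n. \<bar>X n - Y n\<bar> \<le> (b0 - a0) / 2 ^ n"
    "\<And>n. touching_pair (X n) (Y n)" by metis
  have "(\<lambda>n. (b0 - a0) / 2 ^ n) \<longlonglongrightarrow> 0"
    using tendsto_mult_right_zero[OF LIMSEQ_power_zero[of "1/2::real"], of "b0 - a0"]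
    by (simp add: power_one_over)
  then have "(\<lambda>n. X n - Y n) \<longlonglongrightarrow> 0"
    by (rule Lim_null_comparison[rotated]) (use XY(2) in auto)
  then show False using touching_pair_limit[of X a0 b0 Y] XY(1,3) no by blast
qed

text \<open>
  The curve lies in a half plane whose boundary passes through \<open>g u\<close>; the outer normal \<open>w\<close> is then the
  direction of a ray to infinity.
\<close>
definition exposed :: "real \<Rightarrow> bool" where
  "exposed u \<longleftrightarrow> (\<exists>w. w \<noteq> 0 \<and> (\<forall>v. g v \<bullet> w \<le> g u \<bullet> w))"

text \<open>
  A chord longer than \<open>2 / M\<close> has tangent circles of curvature less than \<open>M\<close>. So the maximum of
  \<open>chord_curv x\<close> is attained on the part of the curve in a ball, whose parameters form a compact set.
\<close>
lemma vertex_of_proper_line: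
  assumes inj: "inj g" and proper: "\<And>S. bounded S \<Longrightarrow> bounded (g -` S)"
    and start: "chord_curv x y > 0"
  shows "\<exists>z. \<forall>u. chord_curv z u \<le> chord_curv z z"
proof -
  have unb: "\<not> bounded (g ` {b<..})" "\<not> bounded (g ` {..<b})" for b
  proof -
    have "bounded V" if "bounded (g ` V)" for V
      by (rule bounded_subset[OF proper[OF that]]) auto
    moreover have "\<not> bounded {b<..}"
    proof
      assume "bounded {b<..}"
      then have "bounded ((\<lambda>r. b + r *\<^sub>R 1) ` {0<..})" by (rule bounded_subset) auto
      then show False using unbounded_ray[of "1::real" b] by simp
    qed
    moreover have "\<not> bounded {..<b}"
    proof
      assume "bounded {..<b}"
      then have "bounded ((\<lambda>r. b + r *\<^sub>R (- 1)) ` {0<..})" by (rule bounded_subset) auto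
      then show False using unbounded_ray[of "-1::real" b] by simp
    qed
    ultimately show "\<not> bounded (g ` {b<..})" "\<not> bounded (g ` {..<b})" by blast+
  qed
  have esc: "escapes a b" for a b
    unfolding escapes_def
  proof (intro allI impI)
    fix u assume "g u \<notin> g ` {a..b}"
    then have u: "u \<in> {b<..} \<or> u \<in> {..<a}" by force
    have "connected (g ` V)" if "connected V" for V
      by (rule connected_continuous_image[OF continuous_on_subset[OF cont_g] that]) simp
    moreover have "g ` {b<..} \<inter> g ` {a..b} = {}" "g ` {..<a} \<inter> g ` {a..b} = {}"
      using inj by (auto simp: inj_eq)
    ultimately show "\<exists>C. connected C \<and> \<not> bounded C \<and> g u \<in> C \<and> C \<inter> g ` {a..b} = {} \<and>
          C \<subseteq> range g \<union> - (convex hull range g)"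
      using u unb
      by (elim disjE; intro exI[of _ "g ` {b<..}"] exI[of _ "g ` {..<a}"] conjI) auto
  qed
  define M where "M = chord_curv x y"
  define S where "S = g -` cball (g x) (2 / M)"
  have M: "M > 0" using start by (simp add: M_def)
  have small: "chord_curv x u < M" if "u \<notin> S" for u
  proof -
    have far: "norm (g u - g x) > 2 / M" using that by (simp add: S_def dist_norm norm_minus_commute)
    then have pos: "norm (g u - g x) > 0" using M by (meson divide_pos_pos less_trans zero_less_numeral)
    have "(g u - g x) \<bullet> N x \<le> norm (g u - g x)"
      using norm_cauchy_schwarz[of "g u - g x" "N x"] by (simp add: norm_N)
    then have "chord_curv x u \<le> 2 * norm (g u - g x) / (norm (g u - g x))\<^sup>2"
      using pos by (auto simp: chord_curv_def intro!: divide_right_mono)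
    also have "\<dots> = 2 / norm (g u - g x)" using pos by (simp add: power2_eq_square)
    also have "\<dots> < M" using far pos M by (simp add: field_simps)
    finally show ?thesis .
  qed
  have "compact S"
    unfolding compact_eq_bounded_closed S_def
    by (intro conjI proper closed_vimage) (auto intro: cont_g)
  moreover have y: "y \<in> S" using small[of y] by (auto simp: M_def)
  ultimately have "\<exists>v\<in>S. \<forall>u\<in>S. chord_curv x u \<le> chord_curv x v"
    by (intro continuous_attains_sup continuous_chord_curv_right) auto
  then obtain v where v: "\<And>u. u \<in> S \<Longrightarrow> chord_curv x u \<le> chord_curv x v" by auto
  have "M \<le> chord_curv x v" using v[OF y] by (simp add: M_def)
  then have tp: "touching_pair x v"
    using v small M unfolding touching_pair_def by (metis less_eq_real_def less_le_trans)
  show ?thesis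
  proof (cases "x = v")
    case True
    then show ?thesis using tp by (auto simp: touching_pair_def)
  next
    case False
    then show ?thesis
      by (intro vertex_between[of "min x v" "max x v" 1] esc inj_on_subset[OF inj])
         (use tp in \<open>auto simp: min_def max_def\<close>)
  qed
qed

lemma closed_representative:
  assumes "l > 0" and per: "\<And>s t. g s = g t \<longleftrightarrow> (\<exists>k::int. t = s + of_int k * l)"
  obtains u' where "a \<le> u'" "u' < a + l" "g u' = g u"
proof -
  obtain k :: int where k: "a \<le> u + of_int k * l" "u + of_int k * l < a + l"
    using real_mod_representative[OF assms(1)] by metis
  moreover have "g (u + of_int k * l) = g u" using per[of u "u + of_int k * l"] by metis
  ultimately show ?thesis using that by blast
qed

lemma closed_inj:
  assumes "l > 0" and per: "\<And>s t. g s = g t \<longleftrightarrow> (\<exists>k::int. t = s + of_int k * l)"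
    and "g s = g t" "\<bar>t - s\<bar> < l"
  shows "s = t"
proof -
  obtain k :: int where k: "t = s + of_int k * l" using assms(3) per by blast
  then have "\<bar>of_int k\<bar> * l < 1 * l" using assms(1,4) by (simp add: abs_mult)
  then have "\<bar>of_int k :: real\<bar> < 1" using assms(1) by (simp only: mult_less_cancel_right_pos)
  then have "k = 0" by linarith
  then show ?thesis using k by simp
qed

text \<open>
  The complementary arc from \<open>b\<close> to \<open>a + l\<close> passes through the exposed point and continues along its
  ray.
\<close>
lemma escapes_of_exposed:
  assumes "l > 0" and per: "\<And>s t. g s = g t \<longleftrightarrow> (\<exists>k::int. t = s + of_int k * l)"
    and ab: "a < b" and u0: "b < u0" "u0 < a + l" and ex: "exposed u0"
  shows "escapes a b"
  unfolding escapes_def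
proof (intro allI impI)
  note inj = closed_inj[OF assms(1) per]
  fix u assume u: "g u \<notin> g ` {a..b}"
  obtain u' where u': "a \<le> u'" "u' < a + l" "g u' = g u"
    using closed_representative[OF assms(1) per] by metis
  have u'b: "b < u'" using u u'(1,3) by (metis atLeastAtMost_iff image_eqI not_le)
  obtain w where w: "w \<noteq> 0" "\<And>v. g v \<bullet> w \<le> g u0 \<bullet> w" using ex by (auto simp: exposed_def)
  let ?A = "g ` {b<..<a+l}"
  let ?R = "(\<lambda>r. g u0 + r *\<^sub>R w) ` {0..}"
  have beyond: "g u0 + r *\<^sub>R w \<notin> convex hull range g" if "r > 0" for r
  proof
    assume "g u0 + r *\<^sub>R w \<in> convex hull range g"
    moreover have "convex hull range g \<subseteq> {p. w \<bullet> p \<le> g u0 \<bullet> w}"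
      by (rule hull_minimal) (use w in \<open>auto simp: inner_commute[of w] convex_halfspace_le[of w, unfolded inner_commute[of w]]\<close>)
    ultimately have "w \<bullet> (g u0 + r *\<^sub>R w) \<le> g u0 \<bullet> w" by blast
    then have "r * (w \<bullet> w) \<le> 0" by (simp add: inner_add_right inner_commute)
    then show False using that w(1) by (metis inner_gt_zero_iff mult_pos_pos not_less)
  qed
  have "connected (?A \<union> ?R)"
  proof (rule connected_Un)
    show "connected ?A"
      by (rule connected_continuous_image[OF continuous_on_subset[OF cont_g]]) auto
    show "connected ?R" by (intro connected_continuous_image continuous_intros) auto
    have "g u0 \<in> ?A" "g u0 \<in> ?R" using u0 by (auto intro: image_eqI[of _ _ 0])
    then show "?A \<inter> ?R \<noteq> {}" by blast
  qed
  moreover have "\<not> bounded (?A \<union> ?R)"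
  proof
    assume "bounded (?A \<union> ?R)"
    then have "bounded ((\<lambda>r. g u0 + r *\<^sub>R w) ` {0<..})" by (rule bounded_subset) auto
    then show False using unbounded_ray[OF w(1)] by blast
  qed
  moreover have "g u \<in> ?A \<union> ?R"
    using u'b u'(2,3) by (metis UnI1 greaterThanLessThan_iff image_eqI)
  moreover have "(?A \<union> ?R) \<inter> g ` {a..b} = {}"
  proof -
    have A: "g s \<noteq> g t" if "s \<in> {b<..<a+l}" "t \<in> {a..b}" for s t
      using inj[of s t] that by (auto simp: abs_less_iff)
    have "g u0 + r *\<^sub>R w \<notin> g ` {a..b}" if "r \<ge> 0" for r
    proof (cases "r = 0")
      case True
      have "\<forall>t\<in>{a..b}. g u0 \<noteq> g t" using A[of u0] u0 by simp
      then show ?thesis using True by (simp add: image_iff)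
    next
      case False
      then show ?thesis using beyond[of r] that by (auto intro: hull_inc)
    qed
    then have "?R \<inter> g ` {a..b} = {}" by blast
    moreover have "?A \<inter> g ` {a..b} = {}"
      by (intro equals0I, elim IntE imageE) (metis A)
    ultimately show ?thesis by blast
  qed
  moreover have "?A \<union> ?R \<subseteq> range g \<union> - (convex hull range g)"
  proof -
    have "g u0 + r *\<^sub>R w \<in> range g \<union> - (convex hull range g)" if "r \<ge> 0" for r
      using beyond[of r] that by (cases "r = 0") auto
    then show ?thesis by blast
  qed
  ultimately show "\<exists>C. connected C \<and> \<not> bounded C \<and> g u \<in> C \<and> C \<inter> g ` {a..b} = {} \<and>
          C \<subseteq> range g \<union> - (convex hull range g)" by blast
qed

text \<open>
  The second contact \<open>v\<close> of the disc at \<open>x\<close> differs from one of the two exposed points. That point lies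
  on one of the two arcs between \<open>x\<close> and \<open>v\<close>, and the other arc is the one to which
  \<open>vertex_between\<close> applies. In the second case \<open>v\<close> is replaced by \<open>v - l\<close>, so that the tangency
  stays at \<open>x\<close>.
\<close>
lemma vertex_of_closed_curve_from:
  assumes "l > 0" and per: "\<And>s t. g s = g t \<longleftrightarrow> (\<exists>k::int. t = s + of_int k * l)"
    and start: "chord_curv x u1 > 0"
    and u1: "exposed u1" and u2: "exposed u2"
    and ne: "g u1 \<noteq> g x" "g u2 \<noteq> g x" "g u1 \<noteq> g u2"
  shows "\<exists>z. \<forall>u. chord_curv z u \<le> chord_curv z z"
proof -
  note inj = closed_inj[OF assms(1) per] and rep = closed_representative[OF assms(1) per]
  note esc = escapes_of_exposed[OF assms(1) per]
  have "\<exists>v\<in>{x..x+l}. \<forall>u\<in>{x..x+l}. chord_curv x u \<le> chord_curv x v"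
    using assms(1) by (intro continuous_attains_sup continuous_chord_curv_right) auto
  then obtain v0 where v0: "\<And>u. u \<in> {x..x+l} \<Longrightarrow> chord_curv x u \<le> chord_curv x v0" by blast
  have max: "chord_curv x u \<le> chord_curv x v0" for u
  proof -
    obtain u' where "x \<le> u'" "u' < x + l" "g u' = g u" using rep by metis
    then show ?thesis using v0[of u'] chord_curv_cong[of u' u x] by simp
  qed
  have tp: "touching_pair x v" if "g v = g v0" for v
    using max start order_less_le_trans[OF start max] chord_curv_cong[OF that] by (auto simp: touching_pair_def)
  show ?thesis
  proof (cases "g v0 = g x")
    case True
    then show ?thesis using tp[of x] by (auto simp: touching_pair_def)
  next
    case False
    obtain v where v: "x \<le> v" "v < x + l" "g v = g v0" using rep by metis
    then have vx: "x < v" using False by (cases "x = v") auto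
    obtain u where u: "exposed u" "g u \<noteq> g v" "g u \<noteq> g x"
      using u1 u2 ne v(3) by metis
    obtain u' where u': "x \<le> u'" "u' < x + l" "g u' = g u" using rep by metis
    have ex: "exposed u''" if "g u'' = g u" for u'' using u(1) that by (simp add: exposed_def)
    have u'x: "x < u'" "u' \<noteq> v" using u' u by (cases "x = u'"; auto)+
    have inj_on: "inj_on g {p-\<delta>..q+\<delta>}" if "q - p + 2 * \<delta> < l" for p q \<delta>
      by (rule inj_onI, rule inj) (use that in \<open>auto simp: abs_less_iff\<close>)
    show ?thesis
    proof (cases "v < u'")
      case True
      \<comment> \<open>A third of the complementary arc on either side keeps the parameter range shorter than a period.\<close>
      show ?thesis
      proof (rule vertex_between[of x v "(x + l - v) / 3"])
        show "inj_on g {x - (x + l - v) / 3..v + (x + l - v) / 3}"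
          using v by (intro inj_on) (auto simp: field_simps)
        show "escapes a b" if "x \<le> a" "a < b" "b \<le> v" for a b
          using that True u' u'x by (intro esc[of a b u'] ex) auto
      qed (use v vx tp in auto)
    next
      case False
      have gv: "g (v - l) = g v" using per[of v "v - l"] by (metis diff_add_eq_diff_diff_swap mult_minus1 of_int_1 of_int_minus uminus_add_conv_diff add.commute)
      show ?thesis
      proof (rule vertex_between[of "v - l" x "(v - x) / 3"])
        show "inj_on g {v - l - (v - x) / 3..x + (v - x) / 3}"
          using v vx by (intro inj_on) (auto simp: field_simps)
        show "escapes a b" if "v - l \<le> a" "a < b" "b \<le> x" for a b
          using that False u' u'x by (intro esc[of a b u'] ex) auto
      qed (use v vx tp gv in auto)
    qed
  qed
qed

lemma tangent_at_argmax:
  assumes "\<And>v. g v \<bullet> w \<le> g u \<bullet> w"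
  shows "T u \<bullet> w = 0"
proof -
  have "((\<lambda>v. g v \<bullet> w) has_real_derivative T u \<bullet> w) (at u)"
    using inner_der[of 0 w u] by simp
  then show ?thesis by (rule DERIV_local_max[of _ _ _ 1]) (use assms in auto)
qed

lemma periodic_argmax:
  assumes "l > 0" and per: "\<And>s t. g s = g t \<longleftrightarrow> (\<exists>k::int. t = s + of_int k * l)"
  obtains u where "\<And>v. g v \<bullet> w \<le> g u \<bullet> w"
proof -
  have "\<exists>u\<in>{0..l}. \<forall>v\<in>{0..l}. g v \<bullet> w \<le> g u \<bullet> w"
    using assms(1) by (intro continuous_attains_sup continuous_intros) auto
  then obtain u where u: "\<And>v. v \<in> {0..l} \<Longrightarrow> g v \<bullet> w \<le> g u \<bullet> w" by blast
  have "g v \<bullet> w \<le> g u \<bullet> w" for v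
  proof -
    obtain v' where "0 \<le> v'" "v' < 0 + l" "g v' = g v"
      using closed_representative[OF assms(1) per] by metis
    then show ?thesis using u[of v'] by simp
  qed
  then show ?thesis using that by blast
qed

lemma tangent_determined:
  assumes "T u \<bullet> 1 = 0" "T u \<bullet> \<i> = 0"
  shows False
  using assms norm_T[of u] by (simp add: inner_complex_def cmod_def)

text \<open>
  A leftmost and a topmost point serve as exposed points. They and the rightmost point \<open>g x\<close> are
  distinct, because a point extreme both horizontally and vertically would have no tangent direction.
\<close>
lemma vertex_of_closed_curve:
  assumes "l > 0" and per: "\<And>s t. g s = g t \<longleftrightarrow> (\<exists>k::int. t = s + of_int k * l)"
    and right: "\<And>v. g v \<bullet> 1 \<le> g x \<bullet> 1" and N: "N x = -1"
  shows "\<exists>z. \<forall>u. chord_curv z u \<le> chord_curv z z"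
proof -
  obtain u1 where u1: "\<And>v. g v \<bullet> -1 \<le> g u1 \<bullet> -1" using periodic_argmax[OF assms(1) per] by metis
  obtain u2 where u2: "\<And>v. g v \<bullet> \<i> \<le> g u2 \<bullet> \<i>" using periodic_argmax[OF assms(1) per] by metis
  have left: "g u1 \<bullet> 1 \<le> g v \<bullet> 1" for v using u1[of v] by simp
  have not_right: False if "\<And>v. g v \<bullet> 1 \<le> g u2 \<bullet> 1"
    using tangent_determined[OF tangent_at_argmax[OF that] tangent_at_argmax[OF u2]] .
  have lt: "g u1 \<bullet> 1 < g x \<bullet> 1"
  proof (rule ccontr)
    assume "\<not> g u1 \<bullet> 1 < g x \<bullet> 1"
    then have "g v \<bullet> 1 \<le> g u2 \<bullet> 1" for v using right[of v] left[of u2] by linarith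
    then show False by (rule not_right)
  qed
  show ?thesis
  proof (rule vertex_of_closed_curve_from[OF assms(1) per])
    show "exposed u1" unfolding exposed_def using u1 by (intro exI[of _ "-1"]) auto
    show "exposed u2" unfolding exposed_def using u2 by (intro exI[of _ "\<i>"]) auto
    show ne: "g u1 \<noteq> g x" using lt by auto
    have "(g u1 - g x) \<bullet> N x > 0"
      using lt by (simp add: N inner_diff_left)
    then show "chord_curv x u1 > 0" using ne chord_curv_pos_iff by blast
    show "g u2 \<noteq> g x"
    proof
      assume "g u2 = g x"
      then show False using not_right right by metis
    qed
    show "g u1 \<noteq> g u2"
    proof
      assume "g u1 = g u2"
      then have "T u2 \<bullet> -1 = 0" using tangent_at_argmax[of "-1" u2] u1 by metis
      then have "T u2 \<bullet> 1 = 0" by (simp only: inner_minus_right neg_equal_0_iff_equal)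
      then show False using tangent_determined tangent_at_argmax[OF u2] by blast
    qed
  qed
qed

end

section \<open>Curves on a line or a circle\<close>

lemma continuous_square_constant:
  fixes e :: "real \<Rightarrow> real"
  assumes "continuous_on UNIV e" "\<And>u. (e u)\<^sup>2 = k"
  shows "e u = e v"
proof -
  have "e ` UNIV \<subseteq> {sqrt k, - sqrt k}"
    using assms(2) by (metis (no_types, lifting) image_subsetI insertCI real_sqrt_abs abs_eq_iff' abs_of_nonneg insert_iff real_sqrt_ge_zero zero_le_power2)
  then have "finite (e ` UNIV)" using finite_subset by blast
  then have "e constant_on UNIV"
    using assms(1) by (intro continuous_finite_range_constant) auto
  then show ?thesis by (auto simp: constant_on_def)
qed

context unit_speed_curve
begin

lemma range_line:
  assumes "\<And>u. (g u - g z) \<bullet> N z = 0"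
  shows "range g = range (\<lambda>t. g z + t *\<^sub>R T z)"
proof -
  have TN0: "T u \<bullet> N z = 0" for u
  proof -
    have "((\<lambda>u. (g u - g z) \<bullet> N z) has_real_derivative T u \<bullet> N z) (at u)" by (rule inner_der)
    moreover have "((\<lambda>u. (g u - g z) \<bullet> N z) has_real_derivative 0) (at u)" by (simp add: assms)
    ultimately show ?thesis by (rule DERIV_unique)
  qed
  have "(T u \<bullet> T z)\<^sup>2 = 1" for u
    using norm_frame[of "T u" z] by (simp add: norm_T TN0)
  moreover have "continuous_on UNIV (\<lambda>u. T u \<bullet> T z)" by (intro continuous_intros cont_T)
  ultimately have TT1: "T u \<bullet> T z = 1" for u
    using continuous_square_constant[of "\<lambda>u. T u \<bullet> T z" 1 u z] by (simp add: TT)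
  have "((\<lambda>u. (g u - g z) \<bullet> T z - u) has_real_derivative T u \<bullet> T z - 1) (at u)" for u
    by (intro derivative_intros inner_der)
  then have "((\<lambda>u. (g u - g z) \<bullet> T z - u) has_real_derivative 0) (at u)" for u by (simp add: TT1)
  then have "(g u - g z) \<bullet> T z - u = (g z - g z) \<bullet> T z - z" for u
    using DERIV_isconst_all[of "\<lambda>u. (g u - g z) \<bullet> T z - u" u z] by blast
  then have "(g u - g z) \<bullet> T z = u - z" for u by (simp add: algebra_simps)
  then have eq: "g u = g z + (u - z) *\<^sub>R T z" for u
    using frame_decomposition[of "g u - g z" z] assms[of u] by (metis add.commute add.right_neutral diff_add_cancel scale_zero_left)
  show ?thesis
  proof (intro equalityI subsetI)
    fix p assume "p \<in> range g"
    then obtain u where "p = g u" by auto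
    then show "p \<in> range (\<lambda>t. g z + t *\<^sub>R T z)" using eq[of u] by blast
  next
    fix p assume "p \<in> range (\<lambda>t. g z + t *\<^sub>R T z)"
    then obtain t where "p = g z + t *\<^sub>R T z" by auto
    then have "p = g (z + t)" using eq[of "z + t"] by simp
    then show "p \<in> range g" by simp
  qed
qed

text \<open>
  The hypothesis says that all points are at distance \<open>1 / \<bar>k\<bar>\<close> from the centre \<open>q\<close>. Then \<open>g - q\<close> is a
  multiple of the normal of constant length, and by continuity a constant multiple \<open>E\<close>. So \<open>g - q\<close>
  solves the linear equation \<open>T = w * (g - q)\<close> with imaginary \<open>w\<close>, which is uniform rotation and
  covers the circle.
\<close>
lemma range_circle:
  assumes eq: "\<And>u. 2 * ((g u - g z) \<bullet> N z) = k * (norm (g u - g z))\<^sup>2" and k: "k \<noteq> 0"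
  shows "range g = sphere (g z + (1 / k) *\<^sub>R N z) (1 / \<bar>k\<bar>)"
proof -
  define q where "q = g z + (1 / k) *\<^sub>R N z"
  have sq: "(norm (g u - q))\<^sup>2 = (1 / k)\<^sup>2" for u
  proof -
    have d: "g u - q = (g u - g z) - (1 / k) *\<^sub>R N z" by (simp add: q_def)
    have "(norm (g u - q))\<^sup>2 = (norm (g u - g z))\<^sup>2 - 2 * ((g u - g z) \<bullet> N z) / k + (1 / k)\<^sup>2"
      unfolding d norm_minus_normal by simp
    then show ?thesis using k by (simp add: eq)
  qed
  have tangent: "(g u - q) \<bullet> T u = 0" for u
  proof -
    have "((\<lambda>v. (g v - q) \<bullet> (g v - q)) has_real_derivative 0) (at u)"
      using sq by (simp add: power2_norm_eq_inner)
    from DERIV_unique[OF dist_square_der this] show ?thesis by simp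
  qed
  define e where "e u = (g u - q) \<bullet> N u" for u
  have radial: "g u - q = e u *\<^sub>R N u" for u
    using frame_decomposition[of "g u - q" u] tangent[of u] by (simp add: e_def)
  have "(e u)\<^sup>2 = (1 / k)\<^sup>2" for u using sq[of u] norm_frame[of "g u - q" u] tangent[of u] by (simp add: e_def)
  moreover have "continuous_on UNIV e"
    unfolding e_def by (intro continuous_intros)
  ultimately have e: "e u = e z" for u using continuous_square_constant by blast
  define E where "E = e z"
  have E2: "E\<^sup>2 = (1 / k)\<^sup>2" unfolding E_def by fact
  then have E0: "E \<noteq> 0" using k by auto
  have cc: "c * c = -1" using side by auto
  have Tq: "T u = - c * (g u - q) / complex_of_real E" for u
  proof -
    have "c * (g u - q) = (c * c) * (complex_of_real E * T u)"
      unfolding radial[of u] e[of u] E_def[symmetric] N_def scaleR_conv_of_real by (simp only: mult_ac)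
    then have "- c * (g u - q) = complex_of_real E * T u" by (simp add: cc)
    then show ?thesis using E0 by simp
  qed
  \<comment> \<open>The factor of the linear equation \<open>T = w * (g - q)\<close>.\<close>
  define w where "w = - c / complex_of_real E"
  have "((\<lambda>u. (g u - q) * exp (- (u *\<^sub>R w))) has_vector_derivative
      (g u - q) * (exp (- (u *\<^sub>R w)) * - w) + T u * exp (- (u *\<^sub>R w))) (at u within UNIV)" for u
  proof -
    have "((\<lambda>u. exp (- (u *\<^sub>R w))) has_vector_derivative exp (- (u *\<^sub>R w)) * - w) (at u within UNIV)"
      using exp_scaleR_has_vector_derivative_right[of "- w" u UNIV] by simp
    moreover have "((\<lambda>v. g v - q) has_vector_derivative T u) (at u within UNIV)"
      using has_vector_derivative_diff[OF der_g[of u] has_vector_derivative_const[of q]] by simp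
    ultimately show ?thesis by (rule has_vector_derivative_mult[rotated])
  qed
  moreover have "(g u - q) * (exp (- (u *\<^sub>R w)) * - w) + T u * exp (- (u *\<^sub>R w)) = 0" for u
    unfolding Tq w_def by simp
  ultimately have "((\<lambda>u. (g u - q) * exp (- (u *\<^sub>R w))) has_vector_derivative 0) (at u within UNIV)" for u
    by simp
  then obtain C where C: "\<And>u. (g u - q) * exp (- (u *\<^sub>R w)) = C"
    using has_vector_derivative_zero_constant[of UNIV "\<lambda>u. (g u - q) * exp (- (u *\<^sub>R w))"] by auto
  have g: "g u = q + C * exp (u *\<^sub>R w)" for u
  proof -
    have "(g u - q) * (exp (- (u *\<^sub>R w)) * exp (u *\<^sub>R w)) = C * exp (u *\<^sub>R w)"
      using C[of u] by (simp add: mult.assoc[symmetric])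
    then have "g u - q = C * exp (u *\<^sub>R w)" by (simp add: exp_minus)
    then show ?thesis by (metis add.commute diff_add_cancel)
  qed
  have r: "norm (g u - q) = 1 / \<bar>k\<bar>" for u
    using sq[of u] by (metis abs_norm_cancel abs_divide abs_one power2_eq_iff_nonneg abs_ge_zero power2_abs)
  have nC: "norm C = 1 / \<bar>k\<bar>" using r[of 0] by (simp add: g[of 0])
  show ?thesis
    unfolding q_def[symmetric]
  proof (intro equalityI subsetI)
    fix p assume "p \<in> range g"
    then show "p \<in> sphere q (1 / \<bar>k\<bar>)" using r by (auto simp: dist_norm norm_minus_commute)
  next
    fix p assume "p \<in> sphere q (1 / \<bar>k\<bar>)"
    then have "norm (p - q) = norm C" using nC by (simp add: dist_norm norm_minus_commute)
    moreover have C0: "C \<noteq> 0" using nC k by auto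
    ultimately have "norm ((p - q) / C) = 1" by (simp add: norm_divide)
    then obtain \<theta> where \<theta>: "(p - q) / C = exp (\<i> * of_real \<theta>)"
      using complex_norm_eq_1_exp[of "(p - q) / C"] by metis
    define u where "u = (if c = \<i> then - \<theta> * E else \<theta> * E)"
    have "u *\<^sub>R w = \<i> * of_real \<theta>"
      using side E0 by (auto simp: u_def w_def scaleR_conv_of_real)
    then have "p = g u" using g[of u] \<theta> C0 by (simp add: field_simps)
    then show "p \<in> range g" by simp
  qed
qed

lemma chord_le: "norm (g y - g x) \<le> \<bar>y - x\<bar>"
proof -
  have "norm (g y - g x) \<le> 1 * norm (y - x)"
  proof (rule differentiable_bound[of UNIV g "\<lambda>u h. h *\<^sub>R T u"])
    show "(g has_derivative (\<lambda>h. h *\<^sub>R T u)) (at u within UNIV)" for u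
      using der_g[of u] by (simp add: has_vector_derivative_def)
    show "onorm (\<lambda>h. h *\<^sub>R T u) \<le> 1" for u by (rule onorm_le) (simp add: norm_T)
  qed auto
  then show ?thesis by simp
qed

end

section \<open>Principal values of functions of one sign\<close>

lemma has_pv_integral_inner:
  assumes "has_pv_integral I x F L"
  shows "has_pv_integral I x (\<lambda>y. F y \<bullet> v) (L \<bullet> v)"
proof -
  obtain J where J: "\<And>\<epsilon>. \<epsilon> > 0 \<Longrightarrow> (F has_integral J \<epsilon>) {y \<in> representatives I. param_dist I x y \<ge> \<epsilon>}"
    "(J \<longlongrightarrow> L) (at_right 0)"
    using assms unfolding has_pv_integral_def by blast
  have "((\<lambda>y. F y \<bullet> v) has_integral J \<epsilon> \<bullet> v) {y \<in> representatives I. param_dist I x y \<ge> \<epsilon>}" if "\<epsilon> > 0" for \<epsilon>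
    using has_integral_linear[OF J(1)[OF that] bounded_linear_inner_left[of v]] by (simp add: comp_def)
  moreover have "((\<lambda>\<epsilon>. J \<epsilon> \<bullet> v) \<longlongrightarrow> L \<bullet> v) (at_right 0)" by (intro tendsto_intros J)
  ultimately show ?thesis unfolding has_pv_integral_def by (intro exI[of _ "\<lambda>\<epsilon>. J \<epsilon> \<bullet> v"]) auto
qed

text \<open>
  The truncated integrals increase with \<open>\<epsilon>\<close> and are not positive, and their limit at \<open>0\<close> is \<open>0\<close>; so they
  all vanish. The condition on \<open>\<epsilon>\<close> and \<open>d\<close> places \<open>y\<close> in the interior of one domain of integration.
\<close>
lemma pv_integral_nonpos_eq_0:
  fixes f :: "real \<Rightarrow> real"
  assumes pv: "has_pv_integral I x f 0" and nonpos: "\<And>y. f y \<le> 0"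
    and nbhd: "\<epsilon> > 0" "d > 0" "{y - d..y + d} \<subseteq> {y \<in> representatives I. param_dist I x y \<ge> \<epsilon>}"
    and cont: "continuous_on {y - d..y + d} f"
  shows "f y = 0"
proof -
  let ?S = "\<lambda>\<epsilon>. {y \<in> representatives I. param_dist I x y \<ge> \<epsilon>}"
  obtain J where J: "\<And>\<epsilon>. \<epsilon> > 0 \<Longrightarrow> (f has_integral J \<epsilon>) (?S \<epsilon>)" "(J \<longlongrightarrow> 0) (at_right 0)"
    using pv unfolding has_pv_integral_def by blast
  have mono: "j \<le> i" if "A \<subseteq> B" "(f has_integral i) A" "(f has_integral j) B" for A B i j
    using has_integral_subset_le[OF that(1) has_integral_neg[OF that(2)] has_integral_neg[OF that(3)]] nonpos
    by auto
  have "\<forall>\<^sub>F e in at_right 0. e \<in> {0<..<\<epsilon>}"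
    using nbhd(1) by (rule eventually_at_right_real)
  then have "\<forall>\<^sub>F e in at_right 0. J e \<le> J \<epsilon>"
  proof eventually_elim
    case (elim e)
    show ?case by (rule mono[OF _ J(1) J(1)]) (use elim nbhd(1) in auto)
  qed
  then have "0 \<le> J \<epsilon>" by (rule tendsto_upperbound[OF J(2)]) simp
  have "f integrable_on {y - d..y + d}" using cont by (rule integrable_continuous_real)
  then obtain i where i: "(f has_integral i) {y - d..y + d}" by (auto simp: integrable_on_def)
  have "J \<epsilon> \<le> i" by (rule mono[OF nbhd(3) i J(1)[OF nbhd(1)]])
  moreover have "- i \<ge> 0" using has_integral_nonneg[OF has_integral_neg[OF i]] nonpos by simp
  ultimately have "i = 0" using \<open>0 \<le> J \<epsilon>\<close> by simp
  then have "((\<lambda>y. - f y) has_integral 0) (cbox (y - d) (y + d))" using has_integral_neg[OF i] by simp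
  then have "- f y = 0"
    by (rule has_integral_0_cbox_imp_0[rotated 2]) (use cont nonpos nbhd(2) in \<open>auto intro: continuous_intros\<close>)
  then show ?thesis by simp
qed

section \<open>Planar curves as complex curves\<close>

definition to_complex :: "real^2 \<Rightarrow> complex" where
  "to_complex v = Complex (v $ 1) (v $ 2)"

lemma to_complex_inner: "to_complex u \<bullet> to_complex v = u \<bullet> v"
  by (simp add: to_complex_def inner_complex_def inner_vec_def sum_2)

lemma to_complex_diff: "to_complex (u - v) = to_complex u - to_complex v"
  and to_complex_add: "to_complex (u + v) = to_complex u + to_complex v"
  and to_complex_scaleR: "to_complex (r *\<^sub>R u) = r *\<^sub>R to_complex u"
  by (simp_all add: to_complex_def complex_eq_iff)

lemma norm_to_complex: "norm (to_complex v) = norm v"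
  by (simp add: norm_eq_sqrt_inner to_complex_inner)

lemma bounded_linear_to_complex: "bounded_linear to_complex"
  by (rule bounded_linear_intro[of _ 1])
     (simp_all add: to_complex_add to_complex_scaleR norm_to_complex)

lemma bij_to_complex: "bij to_complex"
proof (rule bijI)
  show "inj to_complex"
    by (rule injI) (simp add: to_complex_def vec_eq_iff forall_2)
  show "surj to_complex"
  proof (rule surjI)
    show "to_complex (vector [Re z, Im z]) = z" for z
      by (simp add: to_complex_def complex_eq_iff)
  qed
qed

lemma is_straight_line_range_of_complex:
  assumes "range (\<lambda>t. to_complex (\<gamma> t)) = range (\<lambda>t. to_complex a + t *\<^sub>R to_complex v)" "v \<noteq> 0"
  shows "is_straight_line (range \<gamma>)"
proof -
  have "to_complex ` range \<gamma> = to_complex ` {a + t *\<^sub>R v | t. True}"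
    using assms(1) by (simp add: image_image full_SetCompr_eq to_complex_add to_complex_scaleR)
  then have "range \<gamma> = {a + t *\<^sub>R v | t. True}"
    using bij_to_complex by (simp add: inj_image_eq_iff bij_is_inj)
  then show ?thesis using assms(2) unfolding is_straight_line_def by blast
qed

lemma is_circle_range_of_complex:
  assumes "range (\<lambda>t. to_complex (\<gamma> t)) = sphere q r" "r > 0"
  shows "is_circle (range \<gamma>)"
proof -
  obtain p where p: "q = to_complex p" using bij_to_complex by (metis bij_pointE)
  have "to_complex ` range \<gamma> = to_complex ` sphere p r"
  proof -
    have "sphere q r = to_complex ` sphere p r"
    proof (intro equalityI subsetI)
      fix z assume z: "z \<in> sphere q r"
      obtain v where v: "z = to_complex v" using bij_to_complex by (metis bij_pointE)
      have "v \<in> sphere p r" using z by (simp add: p v dist_norm norm_to_complex flip: to_complex_diff)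
      then show "z \<in> to_complex ` sphere p r" using v by blast
    qed (auto simp: p dist_norm norm_to_complex simp flip: to_complex_diff)
    then show ?thesis using assms(1) by (simp add: image_image)
  qed
  then have "range \<gamma> = sphere p r"
    using bij_to_complex by (simp add: inj_image_eq_iff bij_is_inj)
  then show ?thesis using assms(2) unfolding is_circle_def by blast
qed

text \<open>
  The parameter distance is the length of a connecting arc. A lower bound on the chord therefore keeps a
  parameter in the domain of integration, on the line and on the circle alike.
\<close>
lemma (in unit_speed_curve) norm_le_param_dist:
  assumes "I = Real_Line \<or> (\<exists>l. I = Real_Mod l \<and> (\<forall>s (k::int). g (s + of_int k * l) = g s))"
  shows "norm (g y - g x) \<le> param_dist I x y"
  using assms
proof
  assume "I = Real_Line" then show ?thesis using chord_le by simp
next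
  assume "\<exists>l. I = Real_Mod l \<and> (\<forall>s (k::int). g (s + of_int k * l) = g s)"
  then obtain l where I: "I = Real_Mod l" and per: "\<And>s k::int. g (s + of_int k * l) = g s" by auto
  have "norm (g y - g x) \<le> \<bar>y - x + of_int k * l\<bar>" for k :: int
    using chord_le[of "y + of_int k * l" x] unfolding per by (simp add: algebra_simps)
  then show ?thesis by (auto simp: I intro: cINF_greatest)
qed

text \<open>
  On the circle the argument reaches only parameters in the interior of \<open>{0..<l}\<close>; the equation extends
  to \<open>0\<close> because it is a closed condition.
\<close>
lemma (in unit_speed_curve) curve_in_tangent_circle:
  assumes I: "I = Real_Line \<or> (\<exists>l>0. I = Real_Mod l \<and> (\<forall>s (k::int). g (s + of_int k * l) = g s))"
    and vertex: "\<And>u. chord_curv z u \<le> chord_curv z z"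
    and pv: "has_pv_integral I z (\<lambda>y. (chord_curv z y - chord_curv z z) / (norm (g y - g z))\<^sup>2) 0"
  shows "2 * ((g u - g z) \<bullet> N z) = chord_curv z z * (norm (g u - g z))\<^sup>2"
proof -
  let ?f = "\<lambda>y. (chord_curv z y - chord_curv z z) / (norm (g y - g z))\<^sup>2"
  let ?Q = "\<lambda>y. 2 * ((g y - g z) \<bullet> N z) = chord_curv z z * (norm (g y - g z))\<^sup>2"
  have dist: "norm (g y - g z) \<le> param_dist I z y" for y
    using I by (intro norm_le_param_dist) auto
  have Q: "?Q y" if y: "{y - d..y + d} \<subseteq> representatives I" "d > 0" for y d
  proof (cases "g y = g z")
    case True then show ?thesis by simp
  next
    case False
    \<comment> \<open>Within \<open>\<epsilon>\<close> of \<open>y\<close> the curve stays at distance at least \<open>\<epsilon>\<close> from \<open>g z\<close>.\<close>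
    define \<epsilon> where "\<epsilon> = norm (g y - g z) / 2"
    define d' where "d' = min d \<epsilon>"
    have pos: "\<epsilon> > 0" "d' > 0" using False y by (auto simp: \<epsilon>_def d'_def)
    have far: "\<epsilon> \<le> norm (g v - g z)" if "v \<in> {y - d'..y + d'}" for v
    proof -
      have "norm (g y - g v) \<le> \<epsilon>" using chord_le[of y v] that by (auto simp: d'_def)
      then show ?thesis
        using norm_triangle_ineq[of "g y - g v" "g v - g z"] by (simp add: \<epsilon>_def)
    qed
    have "?f y = 0"
    proof (rule pv_integral_nonpos_eq_0[OF pv _ pos])
      show "?f v \<le> 0" for v using vertex by (simp add: divide_nonpos_nonneg)
      show "{y - d'..y + d'} \<subseteq> {v \<in> representatives I. \<epsilon> \<le> param_dist I z v}"
      proof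
        fix v assume v: "v \<in> {y - d'..y + d'}"
        then have "v \<in> {y - d..y + d}" by (auto simp: d'_def)
        then show "v \<in> {v \<in> representatives I. \<epsilon> \<le> param_dist I z v}"
          using y(1) order_trans[OF far[OF v] dist] by auto
      qed
      show "continuous_on {y - d'..y + d'} ?f"
      proof (intro continuous_intros continuous_chord_curv_right)
        show "\<forall>v\<in>{y - d'..y + d'}. (norm (g v - g z))\<^sup>2 \<noteq> 0"
          using far pos(1) by fastforce
      qed
    qed
    then have "chord_curv z y = chord_curv z z" using False by simp
    then have "2 * ((g y - g z) \<bullet> N z) / (norm (g y - g z))\<^sup>2 = chord_curv z z"
      using False by (simp add: chord_curv_def[of z y])
    moreover have "(norm (g y - g z))\<^sup>2 \<noteq> 0" using False by simp
    ultimately show ?thesis by (metis nonzero_divide_eq_eq)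
  qed
  from I show ?thesis
  proof
    assume "I = Real_Line"
    then show ?thesis by (intro Q[of _ 1]) auto
  next
    assume "\<exists>l>0. I = Real_Mod l \<and> (\<forall>s (k::int). g (s + of_int k * l) = g s)"
    then obtain l where l: "l > 0" "I = Real_Mod l" and per: "\<And>s k::int. g (s + of_int k * l) = g s" by auto
    have "?Q y" if "y \<in> {0<..<l}" for y
    proof -
      define d where "d = min y (l - y) / 2"
      have "d > 0" "d < y" "d < l - y" using that by (auto simp: d_def)
      then show ?thesis by (intro Q[of y d]) (auto simp: l(2))
    qed
    then have sub: "{0<..<l} \<subseteq> {y. ?Q y}" by auto
    have "closed {y. ?Q y}"
      by (intro closed_Collect_eq continuous_intros)
    from closure_minimal[OF sub this] have "{0..l} \<subseteq> {y. ?Q y}" using l(1) by simp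
    moreover obtain k :: int where "0 \<le> u + of_int k * l" "u + of_int k * l < 0 + l"
      using real_mod_representative[OF l(1)] by metis
    ultimately have "?Q (u + of_int k * l)" using subsetD[of "{0..l}" "{y. ?Q y}" "u + of_int k * l"] by simp
    then show ?thesis unfolding per .
  qed
qed

lemma curvature2_component:
  assumes "norm (vderiv \<gamma> x) = 1" "vderiv \<gamma> x \<bullet> v = 0"
  shows "curvature2 \<gamma> x y \<bullet> v = 2 * ((\<gamma> y - \<gamma> x) \<bullet> v) / (norm (\<gamma> y - \<gamma> x))\<^sup>2"
  by (simp add: curvature2_def tangent_circle_curvature_eq[OF assms(1)] inner_diff_left assms(2))

section \<open>Curves with vanishing principal value\<close>

theorem theorem4p7:
  fixes I :: param_space and \<gamma> :: "real \<Rightarrow> real^2"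
  assumes "I = Real_Line \<or> (\<exists>l>0. I = Real_Mod l)"
    and "smooth_curve \<gamma>"
    and "arc_length_parameterized \<gamma>"
    and "properly_embedded I \<gamma>"
    and "\<And>x. has_pv_integral I x
           (\<lambda>y. (curvature2 \<gamma> x y - curvature \<gamma> x) /\<^sub>R (norm (\<gamma> y - \<gamma> x))\<^sup>2) 0"
  shows "is_straight_line (range \<gamma>) \<or> is_circle (range \<gamma>)"
proof -
  define g where "g t = to_complex (\<gamma> t)" for t
  define T where "T t = to_complex (vderiv \<gamma> t)" for t
  define A where "A t = to_complex (curvature \<gamma> t)" for t
  have g_eq: "g s = g t \<longleftrightarrow> \<gamma> s = \<gamma> t" for s t
    using bij_to_complex by (simp add: g_def inj_eq bij_is_inj)
  have diff: "(vderiv ^^ n) \<gamma> differentiable at t" for n t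
    using assms(2) by (simp add: smooth_curve_def)
  have der: "(f has_vector_derivative vderiv f t) (at t)" if "f differentiable at t"
    for f :: "real \<Rightarrow> real^2" and t
    using that by (simp add: vderiv_def vector_derivative_works)
  have der_g: "(g has_vector_derivative T t) (at t)" for t
    unfolding g_def T_def
    using bounded_linear.has_vector_derivative[OF bounded_linear_to_complex der[OF diff[of 0 t, simplified]]] .
  have der_T: "(T has_vector_derivative A t) (at t)" for t
    unfolding T_def A_def curvature_def
    using bounded_linear.has_vector_derivative[OF bounded_linear_to_complex der[OF diff[of 1 t, simplified]]] .
  have "isCont (curvature \<gamma>) t" for t
    using differentiable_imp_continuous_within[OF diff[of 2 t]]
    by (simp add: numeral_2_eq_2 curvature_def[abs_def])
  then have cont_A: "continuous_on UNIV A"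
    unfolding A_def by (intro continuous_at_imp_continuous_on ballI
      bounded_linear.isCont[OF bounded_linear_to_complex])
  have norm_T: "norm (T t) = 1" for t
    using assms(3) by (simp add: T_def norm_to_complex arc_length_parameterized_def)
  have recur: "g (u + (t - s)) = g u" if eq: "g s = g t" for s t u
    using assms(1)
  proof
    assume "I = Real_Line"
    then have "s = t" using assms(4) that by (simp add: g_eq inj_eq)
    then show ?thesis by simp
  next
    assume "\<exists>l>0. I = Real_Mod l"
    then obtain l where "I = Real_Mod l" by blast
    then have *: "\<And>s t. g s = g t \<longleftrightarrow> (\<exists>k::int. t = s + of_int k * l)"
      using assms(4) by (simp add: g_eq)
    obtain k :: int where "t = s + of_int k * l" using *[of s t] eq by blast
    then have "u + (t - s) = u + of_int k * l" by simp
    then show ?thesis using *[of u "u + (t - s)"] by metis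
  qed
  have curve: "unit_speed_curve g T A c" if "c = \<i> \<or> c = - \<i>" for c
    by unfold_locales (use der_g der_T cont_A norm_T recur that in auto)
  \<comment> \<open>The two choices of the normal.\<close>
  interpret L: unit_speed_curve g T A "\<i>" by (rule curve) simp
  interpret R: unit_speed_curve g T A "- \<i>" by (rule curve) simp
  have N_R: "R.N t = - L.N t" for t by (simp add: R.N_def L.N_def)
  have cc_R: "R.chord_curv x y = - L.chord_curv x y" for x y
    by (simp add: R.chord_curv_def L.chord_curv_def N_R)
  have "\<exists>c z. (c = \<i> \<or> c = - \<i>) \<and>
      (\<forall>u. unit_speed_curve.chord_curv g T A c z u \<le> unit_speed_curve.chord_curv g T A c z z)"
    using assms(1)
  proof
    assume I: "I = Real_Line"
    have inj: "inj g" using assms(4) I by (simp add: inj_def g_eq)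
    have proper: "bounded (g -` S)" if "bounded S" for S
    proof -
      have "bounded (to_complex -` S)"
        using that unfolding bounded_iff by (metis norm_to_complex vimageE)
      then have "compactin euclidean (closure (to_complex -` S))"
        by (simp add: compact_closure)
      then have "compact {t. \<gamma> t \<in> closure (to_complex -` S)}"
        using compactin_proper_map_preimage[of euclidean euclidean \<gamma>] assms(4) I by simp
      moreover have "g -` S \<subseteq> {t. \<gamma> t \<in> closure (to_complex -` S)}"
        using closure_subset[of "to_complex -` S"] by (auto simp: g_def)
      ultimately show ?thesis using bounded_subset compact_imp_bounded by blast
    qed
    consider x y where "L.chord_curv x y > 0" | x y where "R.chord_curv x y > 0"
      | "\<And>x y. L.chord_curv x y = 0"
      by (metis cc_R linorder_neqE_linordered_idom neg_0_less_iff_less)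
    then show ?thesis
    proof cases
      case 1
      from L.vertex_of_proper_line[OF inj proper this] show ?thesis by blast
    next
      case 2
      from R.vertex_of_proper_line[OF inj proper this] show ?thesis by blast
    next
      case 3
      then show ?thesis by (intro exI[of _ "\<i>"] exI[of _ 0]) simp
    qed
  next
    assume "\<exists>l>0. I = Real_Mod l"
    then obtain l where l: "l > 0" "I = Real_Mod l" by blast
    then have per: "\<And>s t. g s = g t \<longleftrightarrow> (\<exists>k::int. t = s + of_int k * l)"
      using assms(4) by (simp add: g_eq)
    obtain x where x: "\<And>v. g v \<bullet> 1 \<le> g x \<bullet> 1" using L.periodic_argmax[OF l(1) per] by metis
    have "T x \<bullet> 1 = 0" by (rule L.tangent_at_argmax) (rule x)
    then have "Re (T x) = 0" by simp
    moreover then have "Im (T x) = 1 \<or> Im (T x) = -1"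
      using norm_T[of x] by (simp add: cmod_def) linarith
    ultimately have "L.N x = -1 \<or> R.N x = -1"
      by (auto simp: L.N_def R.N_def complex_eq_iff)
    then show ?thesis
    proof
      assume "L.N x = -1"
      from L.vertex_of_closed_curve[OF l(1) per x this] show ?thesis by blast
    next
      assume "R.N x = -1"
      from R.vertex_of_closed_curve[OF l(1) per x this] show ?thesis by blast
    qed
  qed
  then obtain c z where c: "c = \<i> \<or> c = - \<i>"
    and vertex: "\<And>u. unit_speed_curve.chord_curv g T A c z u \<le> unit_speed_curve.chord_curv g T A c z z"
    by blast
  interpret C: unit_speed_curve g T A c using c by (rule curve)
  obtain \<nu> where \<nu>: "C.N z = to_complex \<nu>" using bij_to_complex by (metis bij_pointE)
  have chord: "norm (\<gamma> y - \<gamma> x) = norm (g y - g x)" for x y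
    by (simp add: g_def norm_to_complex flip: to_complex_diff)
  have "((curvature2 \<gamma> z y - curvature \<gamma> z) /\<^sub>R (norm (\<gamma> y - \<gamma> z))\<^sup>2) \<bullet> \<nu>
      = (C.chord_curv z y - C.chord_curv z z) / (norm (g y - g z))\<^sup>2" for y
  proof (cases "g y = g z")
    case True
    then show ?thesis by (simp add: g_eq)
  next
    case False
    have "vderiv \<gamma> z \<bullet> \<nu> = 0"
      using C.TN[of z] by (simp add: \<nu> T_def to_complex_inner)
    moreover have "norm (vderiv \<gamma> z) = 1" using assms(3) by (simp add: arc_length_parameterized_def)
    ultimately have "curvature2 \<gamma> z y \<bullet> \<nu> = 2 * ((\<gamma> y - \<gamma> z) \<bullet> \<nu>) / (norm (\<gamma> y - \<gamma> z))\<^sup>2"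
      by (intro curvature2_component)
    also have "(\<gamma> y - \<gamma> z) \<bullet> \<nu> = (g y - g z) \<bullet> C.N z"
      by (simp add: \<nu> g_def to_complex_inner flip: to_complex_diff)
    finally have "curvature2 \<gamma> z y \<bullet> \<nu> = C.chord_curv z y"
      using False by (simp add: C.chord_curv_def chord)
    moreover have "curvature \<gamma> z \<bullet> \<nu> = C.chord_curv z z"
      by (simp add: C.chord_curv_def \<nu> A_def to_complex_inner)
    ultimately show ?thesis
      by (simp add: inner_diff_left chord divide_inverse mult.commute)
  qed
  then have pv: "has_pv_integral I z (\<lambda>y. (C.chord_curv z y - C.chord_curv z z) / (norm (g y - g z))\<^sup>2) 0"
    using has_pv_integral_inner[OF assms(5)[of z], of \<nu>] by simp
  have I: "I = Real_Line \<or> (\<exists>l>0. I = Real_Mod l \<and> (\<forall>s (k::int). g (s + of_int k * l) = g s))"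
    using assms(1)
  proof
    assume "\<exists>l>0. I = Real_Mod l"
    then obtain l where l: "l > 0" "I = Real_Mod l" by blast
    then have "g s = g (s + of_int k * l)" for s and k :: int
      using assms(4) by (auto simp: g_eq)
    then show ?thesis using l by metis
  qed simp
  have on_circle: "2 * ((g u - g z) \<bullet> C.N z) = C.chord_curv z z * (norm (g u - g z))\<^sup>2" for u
    by (rule C.curve_in_tangent_circle[OF I vertex pv])
  show ?thesis
  proof (cases "C.chord_curv z z = 0")
    case True
    then have "range g = range (\<lambda>t. g z + t *\<^sub>R T z)" using on_circle by (intro C.range_line) simp
    moreover have "vderiv \<gamma> z \<noteq> 0"
      using assms(3) unfolding arc_length_parameterized_def by (metis norm_zero zero_neq_one)
    ultimately show ?thesis
      using is_straight_line_range_of_complex[of \<gamma> "\<gamma> z" "vderiv \<gamma> z"] unfolding g_def T_def by blast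
  next
    case False
    from C.range_circle[OF on_circle this] show ?thesis
      using is_circle_range_of_complex[of \<gamma>] False unfolding g_def by simp
  qed
qed

end
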